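(* Let $m,n\ge 1$ be integers and let $\pi$ be a partition of $\{1,\dots,m+n\}$ such that every component of $\pi$ has at least $n+1$ elements. Let $\psi:\mathbb{N}\to(0,\infty)$ be a function such that $x\mapsto x^{m-1}\psi(x)^n$ is non-increasing on $\mathbb{N}$. If $\sum_{j\ge 1} j^{m-1}\psi(j)^n=\infty$, then for almost every pair $(\Theta,\mathbf{y})\in \mathrm{Mat}_{n,m}(\mathbb{R})\times\mathbb{R}^n$ there exist infinitely many points $(\mathbf{q},\mathbf{p})^t\in P(\pi)$, with $\mathbf{q}\in\mathbb{Z}^m\setminus\{0\}$ and $\mathbf{p}\in\mathbb{Z}^n$, such that $$|\Theta\mathbf{q}+\mathbf{p}-\mathbf{y}|\le\psi(|\mathbf{q}|).$$ Conversely, if $\sum_{j\ge 1} j^{m-1}\psi(j)^n<\infty$, then for almost every pair $(\Theta,\mathbf{y})\in \mathrm{Mat}_{n,m}(\mathbb{R})\times\mathbb{R}^n$ there exist only finitely many integer points $(\mathbf{q},\mathbf{p})^t\in\mathbb{Z}^{m+n}$, with $\mathbf{q}\in\mathbb{Z}^m\setminus\{0\}$, $\mathbf{p}\in\mathbb{Z}^n$, satisfying $|\Theta\mathbf{q}+\mathbf{p}-\mathbf{y}|\le\psi(|\mathbf{q}|)$.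
   Context: $\mathbb{N}=\{1,2,\dots\}$. $\mathrm{Mat}_{n,m}(\mathbb{R})$ is the space of real $n\times m$ matrices; vectors are columns, and $(\mathbf{q},\mathbf{p})^t\in\mathbb{R}^{m+n}$ denotes the column vector obtained by stacking $\mathbf{q}\in\mathbb{R}^m$ above $\mathbf{p}\in\mathbb{R}^n$. $|\cdot|$ is the supremum norm. "Almost every" refers to Lebesgue measure. For a partition $\pi$ of $\{1,\dots,d\}$ whose components $\pi_1,\dots,\pi_k$ each have at least two elements, $P(\pi)$ is the set of $\mathbf{v}=(v_1,\dots,v_d)^t\in\mathbb{Z}^d$ such that for every component $\pi_j$ one has $\gcd(v_i : i\in\pi_j)=1$. *)

theory Defs
  imports "HOL-Analysis.Analysis"
begin

text \<open>
  The dimensions are \<open>m = CARD('m)\<close> and \<open>n = CARD('n)\<close>. The coordinates of the stacked space of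
  dimension \<open>m + n\<close> are indexed by the sum type \<open>'m + 'n\<close>, which plays the role of
  \<open>{1, ..., m + n}\<close>: \<open>Inl\<close> stands for the first \<open>m\<close> indices and \<open>Inr\<close> for the last \<open>n\<close>.
\<close>

definition stack :: "'a ^ 'm \<Rightarrow> 'a ^ 'n \<Rightarrow> 'a ^ ('m + 'n)" where
  "stack q p = (\<chi> i. case i of Inl a \<Rightarrow> q $ a | Inr b \<Rightarrow> p $ b)"

definition P :: "'d set set \<Rightarrow> (int ^ 'd) set" where
  "P \<pi> = {v. \<forall>B\<in>\<pi>. (GCD i\<in>B. v $ i) = 1}"

definition real_vec :: "int ^ 'd \<Rightarrow> real ^ 'd" where
  "real_vec v = (\<chi> i. real_of_int (v $ i))"

text \<open>The supremum norm of an integer vector as a natural number, so that it can be an argument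
  of a function on the natural numbers; on real vectors the supremum norm is \<^const>\<open>infnorm\<close>.\<close>

definition int_supnorm :: "int ^ 'd \<Rightarrow> nat" where
  "int_supnorm v = Max (range (\<lambda>i. nat \<bar>v $ i\<bar>))"

lemma of_nat_int_supnorm: "real (int_supnorm v) = infnorm (real_vec v)"
proof -
  have "real (int_supnorm v) = Max (real ` range (\<lambda>i. nat \<bar>v $ i\<bar>))"
    unfolding int_supnorm_def by (intro mono_Max_commute) (auto simp: mono_def)
  also have "real ` range (\<lambda>i. nat \<bar>v $ i\<bar>) = range (\<lambda>i. \<bar>real_vec v $ i\<bar>)"
    by (auto simp: image_image real_vec_def)
  also have "Max \<dots> = Sup (range (\<lambda>i. \<bar>real_vec v $ i\<bar>))"
    by (intro cSup_eq_Max [symmetric]) auto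
  also have "\<dots> = infnorm (real_vec v)"
    unfolding infnorm_cart by (intro arg_cong [where f = Sup]) auto
  finally show ?thesis .
qed

end

theory Submission
  imports Defs
begin

text \<open>
  The convergence half is the Borel--Cantelli lemma applied to the shells \<open>|q| = k\<close>.

  For the divergence half one may truncate \<open>\<psi>\<close> so that \<open>\<psi> \<le> 1/4\<close>. Every component of \<open>\<pi>\<close> either
  contains two of the first \<open>m\<close> indices or contains the only such index \<open>i\<close> together with all of the
  last \<open>n\<close>. Hence \<open>P(\<pi>)\<close> contains all \<open>(q, p)\<close> with \<open>q\<close> subject to coprimality of certain disjoint
  pairs of coordinates and \<open>gcd (q\<^sub>i, p\<^sub>l) = 1\<close>, for suitable \<open>i\<close>, \<open>l\<close>. Restrict further to
  \<open>q\<^sub>i = |q| = k\<close>, where \<open>k\<close> runs through a set of positive density whose members have few small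
  divisors; there are still at least \<open>c k\<^bsup>m-1\<^esup>\<close> such \<open>q\<close> for each \<open>k\<close>.

  Let \<open>A q\<close> be the set of \<open>(\<Theta>, y)\<close> that admit some \<open>p\<close>, and \<open>A' q \<subseteq> A q\<close> the set of those that admit
  some \<open>p\<close> with \<open>gcd (q\<^sub>i, p\<^sub>l) = 1\<close>. On bounded sets the \<open>A q\<close> are quasi-independent, since
  \<open>\<Theta>q - y\<close> and \<open>\<Theta>q' - y\<close> decouple modulo \<open>1\<close> when \<open>q \<noteq> q'\<close>. On each bounded open \<open>U\<close>, the set \<open>A' q\<close>
  has measure at least \<open>c |U| \<psi>(|q|)\<^sup>n\<close> once \<open>|q|\<close> is large, with \<open>c\<close> independent of \<open>U\<close>. If the
  set \<open>E\<close> of points avoiding all \<open>A' q\<close> with \<open>|q| \<ge> j\<close> had positive measure, take \<open>U \<supseteq> E\<close> with \<open>U - E\<close> small: the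
  counting function of the \<open>A' q\<close> then has all its mass, a fixed proportion of the total, on \<open>U - E\<close>,
  which the second moment bound for the \<open>A q\<close> forbids.
\<close>

subsection \<open>Integers with sparse divisors\<close>

text \<open>A member \<open>a\<close> of this set is coprime to at least about a fifth of the integers in any interval
  of length much larger than the number of divisors of \<open>a\<close>; the bound \<open>4/5\<close> is below \<open>1\<close> but above
  the mean \<open>\<le> 13/20\<close> of the divisor sum, so that the set has positive density.\<close>

definition divisor_sparse :: "nat set" where
  "divisor_sparse = {a. a > 0 \<and> (\<Sum>d | d dvd a \<and> 2 \<le> d. 1 / real d) \<le> 4 / 5}"

lemma sum_inverse_squares_le: "(\<Sum>d=2..N. 1 / (real d)\<^sup>2) \<le> 13 / 20"
proof -
  \<comment> \<open>The subtracted term is the telescoped tail and lets the induction close. The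
    constant 13/20 gives equality at \<open>N = 2\<close>; the full series sums to pi^2/6 - 1, just
    below it.\<close>
  have *: "(\<Sum>d=2..N. 1 / (real d)\<^sup>2) \<le> 13 / 20 - 1 / (real N + 1 / 2)" if "N \<ge> 2" for N
    using that
  proof (induction N rule: nat_induct_at_least)
    case base
    then show ?case by (simp add: field_simps power2_eq_square)
  next
    case (Suc k)
    \<comment> \<open>\<open>1/d\<^sup>2 \<le> 1/(d - 1/2) - 1/(d + 1/2)\<close> telescopes.\<close>
    have "1 / (real (Suc k))\<^sup>2 \<le> 1 / (real k + 1 / 2) - 1 / (real (Suc k) + 1 / 2)"
      by (simp add: divide_simps power2_eq_square) (simp add: algebra_simps)
    then show ?case using Suc by (simp add: atLeastAtMostSuc_conv)
  qed
  show ?thesis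
  proof (cases "N \<ge> 2")
    case True
    have "1 / (real N + 1 / 2) \<ge> 0" by simp
    then show ?thesis using *[OF True] by linarith
  qed auto
qed

lemma card_multiples_le:
  assumes "d > 0"
  shows "real (card {k\<in>{1..N}. d dvd k}) \<le> real N / real d"
proof -
  have "{k\<in>{1..N}. d dvd k} \<subseteq> (\<lambda>i. d * i) ` {1..N div d}"
    using assms by (auto elim!: dvdE simp: less_eq_div_iff_mult_less_eq mult.commute
        intro!: imageI)
  then have "card {k\<in>{1..N}. d dvd k} \<le> card ((\<lambda>i. d * i) ` {1..N div d})"
    by (intro card_mono) auto
  also have "\<dots> \<le> N div d" using card_image_le[of "{1..N div d}"] by simp
  finally have "card {k\<in>{1..N}. d dvd k} \<le> N div d" .
  then have "real (card {k\<in>{1..N}. d dvd k}) \<le> real (N div d)" by simp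
  also have "\<dots> \<le> real N / real d" by (rule of_nat_div_le_of_nat)
  finally show ?thesis .
qed

text \<open>Markov's inequality. Exchanging sums shows that the divisor sum has mean at most 13/20
  on {1..N}, so at most a proportion (13/20) / (4/5) = 13/16 of these integers can exceed
  4/5.\<close>

lemma card_divisor_sparse_ge: "3 / 16 * real N \<le> real (card {k\<in>{1..N}. k \<in> divisor_sparse})"
proof -
  define D where "D k = (\<Sum>d | d dvd k \<and> 2 \<le> d. 1 / real d)" for k :: nat
  have D: "D k = (\<Sum>d=2..N. if d dvd k then 1 / real d else 0)" if "k \<in> {1..N}" for k
    unfolding D_def using that
    by (intro sum.mono_neutral_cong_left) (auto dest: dvd_imp_le)
  have "(\<Sum>k=1..N. D k) = (\<Sum>d=2..N. \<Sum>k=1..N. if d dvd k then 1 / real d else 0)"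
    by (subst sum.swap) (intro sum.cong refl D)
  also have "\<dots> = (\<Sum>d=2..N. real (card {k\<in>{1..N}. d dvd k}) * (1 / real d))"
    by (intro sum.cong refl) (simp add: sum.If_cases Int_def)
  also have "\<dots> \<le> (\<Sum>d=2..N. real N * (1 / (real d)\<^sup>2))"
  proof (intro sum_mono)
    fix d assume "d \<in> {2..N}"
    then have "real (card {k\<in>{1..N}. d dvd k}) * (1 / real d) \<le> real N / real d * (1 / real d)"
      by (intro mult_right_mono card_multiples_le) auto
    then show "real (card {k\<in>{1..N}. d dvd k}) * (1 / real d) \<le> real N * (1 / (real d)\<^sup>2)"
      by (simp add: power2_eq_square)
  qed
  also have "\<dots> = real N * (\<Sum>d=2..N. 1 / (real d)\<^sup>2)" by (simp add: sum_distrib_left)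
  also have "\<dots> \<le> real N * (13 / 20)" by (intro mult_left_mono sum_inverse_squares_le) auto
  finally have up: "(\<Sum>k=1..N. D k) \<le> real N * (13 / 20)" .
  define Bad where "Bad = {k\<in>{1..N}. k \<notin> divisor_sparse}"
  have "real (card Bad) * (4 / 5) = (\<Sum>k\<in>Bad. 4 / 5)" by simp
  also have "\<dots> \<le> (\<Sum>k\<in>Bad. D k)"
    by (intro sum_mono) (auto simp: Bad_def D_def divisor_sparse_def)
  also have "\<dots> \<le> (\<Sum>k=1..N. D k)"
    by (intro sum_mono2) (auto simp: Bad_def D_def intro: sum_nonneg)
  finally have bad: "real (card Bad) \<le> 13 / 16 * real N" using up by simp
  have "card Bad + card {k\<in>{1..N}. k \<in> divisor_sparse} = card (Bad \<union> {k\<in>{1..N}. k \<in> divisor_sparse})"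
    by (intro card_Un_disjoint[symmetric]) (auto simp: Bad_def)
  also have "Bad \<union> {k\<in>{1..N}. k \<in> divisor_sparse} = {1..N}" by (auto simp: Bad_def)
  finally have "real (card Bad) + real (card {k\<in>{1..N}. k \<in> divisor_sparse}) = real N"
    by (simp flip: of_nat_add)
  then show ?thesis using bad by linarith
qed

text \<open>A divisor larger than \<open>t\<close> has the form \<open>a div e\<close> with
  \<open>e\<close> at most a/t. With \<open>t\<close> fixed and \<open>a\<close> large this makes
  the number of divisors a small fraction of \<open>a\<close>, which is all that is needed of
  it.\<close>

lemma card_divisors_le:
  assumes "a > 0" "t > 0"
  shows "real (card {d. d dvd a}) \<le> real t + real a / real t"
proof -
  have "{d. d dvd a} \<subseteq> {1..t} \<union> (\<lambda>e. a div e) ` {1..a div t}"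
  proof
    fix d assume "d \<in> {d. d dvd a}"
    then obtain e where e: "a = d * e" by (auto elim: dvdE)
    show "d \<in> {1..t} \<union> (\<lambda>e. a div e) ` {1..a div t}"
    proof (cases "d \<le> t")
      case False
      have "e \<in> {1..a div t}" using False e assms
        by (auto simp: less_eq_div_iff_mult_less_eq mult.commute intro!: mult_mono)
      moreover have "d = a div e" using e assms by auto
      ultimately show ?thesis by blast
    qed (use e assms in \<open>auto simp: Suc_le_eq\<close>)
  qed
  then have "card {d. d dvd a} \<le> card ({1..t} \<union> (\<lambda>e. a div e) ` {1..a div t})"
    by (intro card_mono) auto
  also have "\<dots> \<le> card {1..t} + card ((\<lambda>e. a div e) ` {1..a div t})" by (rule card_Un_le)
  also have "\<dots> \<le> t + a div t" using card_image_le[of "{1..a div t}" "\<lambda>e. a div e"] by simp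
  finally have "real (card {d. d dvd a}) \<le> real (t + a div t)" by simp
  also have "\<dots> \<le> real t + real a / real t" using of_nat_div_le_of_nat[of a t] by simp
  finally show ?thesis .
qed

lemma card_multiples_interval_le:
  fixes A :: int
  assumes "d > 0"
  shows "real (card {x\<in>{A<..A + int L}. int d dvd x}) \<le> real L / real d + 1"
proof -
  have "{x\<in>{A<..A + int L}. int d dvd x} \<subseteq> (\<lambda>i. int d * i) ` {A div int d<..(A + int L) div int d}"
  proof
    fix x assume "x \<in> {x\<in>{A<..A + int L}. int d dvd x}"
    then obtain i where i: "x = int d * i" "A < int d * i" "int d * i \<le> A + int L"
      by (auto elim: dvdE)
    have "A div int d < i"
    proof (rule ccontr)
      assume "\<not> A div int d < i"
      then have "int d * i \<le> int d * (A div int d)" by (intro mult_left_mono) auto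
      also have "\<dots> \<le> A" using assms
        by (metis minus_mod_eq_mult_div pos_mod_sign of_nat_0_less_iff diff_le_eq le_add_same_cancel1)
      finally show False using i(2) by simp
    qed
    moreover have "i \<le> (A + int L) div int d"
      using i(3) assms by (metis mult.commute of_nat_0_less_iff nonzero_mult_div_cancel_left zdiv_mono1 less_numeral_extra(3) of_nat_eq_0_iff)
    ultimately show "x \<in> (\<lambda>i. int d * i) ` {A div int d<..(A + int L) div int d}"
      using i by auto
  qed
  then have "card {x\<in>{A<..A + int L}. int d dvd x} \<le> card ((\<lambda>i. int d * i) ` {A div int d<..(A + int L) div int d})"
    by (intro card_mono) auto
  also have "\<dots> \<le> nat ((A + int L) div int d - A div int d)"
    using card_image_le[of "{A div int d<..(A + int L) div int d}"] by simp
  finally have c: "card {x\<in>{A<..A + int L}. int d dvd x} \<le> nat ((A + int L) div int d - A div int d)" .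
  have "A div int d \<le> (A + int L) div int d" using assms by (intro zdiv_mono1) auto
  then have "real (card {x\<in>{A<..A + int L}. int d dvd x}) \<le> real_of_int ((A + int L) div int d) - real_of_int (A div int d)"
    using c by linarith
  also have "\<dots> \<le> (real_of_int A + real L) / real d - (real_of_int A / real d - 1)"
  proof -
    have "real_of_int ((A + int L) div int d) \<le> real_of_int (A + int L) / real_of_int (int d)"
      by (metis floor_divide_of_int_eq of_int_floor_le)
    moreover have "real_of_int A / real_of_int (int d) - 1 \<le> real_of_int (A div int d)"
      by (metis floor_divide_of_int_eq diff_le_eq le_less real_of_int_floor_add_one_gt)
    ultimately show ?thesis by simp
  qed
  also have "\<dots> = real L / real d + 1" by (simp add: add_divide_distrib)
  finally show ?thesis .
qed

text \<open>Union bound over the divisors d \<ge> 2 of \<open>a\<close>, a nontrivial gcd being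
  itself such a divisor. The main terms L/d add up to at most 4L/5, and the rounding errors to at
  most the number of divisors of \<open>a\<close>.\<close>

lemma card_coprime_interval_ge:
  fixes A :: int
  assumes "a \<in> divisor_sparse" "t > 0"
  shows "real (card {x\<in>{A<..A + int L}. coprime (int a) x}) \<ge> real L / 5 - real t - real a / real t"
proof -
  have a: "a > 0" using assms by (simp add: divisor_sparse_def)
  define D where "D = {d. d dvd a \<and> 2 \<le> d}"
  have fD: "finite D" unfolding D_def using a by (auto intro: finite_subset[OF _ finite_divisors_nat[of a]])
  have "{x\<in>{A<..A + int L}. \<not> coprime (int a) x} \<subseteq> (\<Union>d\<in>D. {x\<in>{A<..A + int L}. int d dvd x})"
  proof
    fix x assume x: "x \<in> {x\<in>{A<..A + int L}. \<not> coprime (int a) x}"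
    define d where "d = nat (gcd (int a) x)"
    have id: "int d = gcd (int a) x" by (simp add: d_def)
    have "d \<noteq> 1" using x id by (auto simp: coprime_iff_gcd_eq_1)
    moreover have "d \<noteq> 0" using id a by (metis gcd_eq_0_iff of_nat_0 of_nat_eq_0_iff not_gr_zero)
    moreover have "d dvd a" by (metis id gcd_dvd1 int_dvd_int_iff)
    moreover have "int d dvd x" by (simp add: id)
    ultimately show "x \<in> (\<Union>d\<in>D. {x\<in>{A<..A + int L}. int d dvd x})"
      using x by (auto simp: D_def)
  qed
  then have "card {x\<in>{A<..A + int L}. \<not> coprime (int a) x} \<le> card (\<Union>d\<in>D. {x\<in>{A<..A + int L}. int d dvd x})"
    using fD by (intro card_mono finite_UN_I) (auto intro: finite_subset[OF _ finite_greaterThanAtMost_int])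
  also have "\<dots> \<le> (\<Sum>d\<in>D. card {x\<in>{A<..A + int L}. int d dvd x})" by (rule card_UN_le[OF fD])
  finally have "real (card {x\<in>{A<..A + int L}. \<not> coprime (int a) x}) \<le> (\<Sum>d\<in>D. real (card {x\<in>{A<..A + int L}. int d dvd x}))"
    by (simp flip: of_nat_sum)
  also have "\<dots> \<le> (\<Sum>d\<in>D. real L * (1 / real d) + 1)"
    by (intro sum_mono) (use card_multiples_interval_le[of _ A L] in \<open>auto simp: D_def\<close>)
  also have "\<dots> = real L * (\<Sum>d\<in>D. 1 / real d) + real (card D)"
    by (simp add: sum.distrib sum_distrib_left)
  also have "\<dots> \<le> real L * (4 / 5) + (real t + real a / real t)"
  proof (intro add_mono mult_left_mono)
    show "(\<Sum>d\<in>D. 1 / real d) \<le> 4 / 5" using assms by (simp add: divisor_sparse_def D_def)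
    have "card D \<le> card {d. d dvd a}" unfolding D_def by (intro card_mono) (use a in auto)
    then show "real (card D) \<le> real t + real a / real t"
      using card_divisors_le[OF a assms(2)] by linarith
  qed auto
  finally have nc: "real (card {x\<in>{A<..A + int L}. \<not> coprime (int a) x}) \<le> real L * (4 / 5) + (real t + real a / real t)" .
  have "card {x\<in>{A<..A + int L}. \<not> coprime (int a) x} + card {x\<in>{A<..A + int L}. coprime (int a) x}
      = card ({x\<in>{A<..A + int L}. \<not> coprime (int a) x} \<union> {x\<in>{A<..A + int L}. coprime (int a) x})"
    by (intro card_Un_disjoint[symmetric]) (auto intro: finite_subset[OF _ finite_greaterThanAtMost_int[of A "A + int L"]])
  also have "{x\<in>{A<..A + int L}. \<not> coprime (int a) x} \<union> {x\<in>{A<..A + int L}. coprime (int a) x} = {A<..A + int L}"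
    by auto
  finally have "real (card {x\<in>{A<..A + int L}. \<not> coprime (int a) x}) + real (card {x\<in>{A<..A + int L}. coprime (int a) x}) = real L"
    by (simp flip: of_nat_add)
  then show ?thesis using nc by linarith
qed

text \<open>Density in every initial segment passes to sums with non-increasing weights. This is how
  monotonicity of the summand lets divergence survive the restriction to
  \<open>divisor_sparse\<close>.\<close>

lemma sum_divisor_sparse_ge:
  assumes "\<And>i j. 1 \<le> i \<Longrightarrow> i \<le> j \<Longrightarrow> T j \<le> T i" "\<And>i. T i \<ge> (0::real)"
  shows "3 / 16 * (\<Sum>k=1..N. T k) \<le> (\<Sum>k\<in>{1..N} \<inter> divisor_sparse. T k)"
proof -
  \<comment> \<open>Summation by parts against the partial sums of \<open>e\<close>, which are nonnegative.\<close>
  define e :: "nat \<Rightarrow> real" where "e k = (if k \<in> divisor_sparse then 1 else 0) - 3 / 16" for k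
  have e: "(\<Sum>k=1..N. e k) \<ge> 0" for N
    using card_divisor_sparse_ge[of N]
    by (simp add: e_def sum_subtractf sum.If_cases Int_def)
  have "T N * (\<Sum>k=1..N. e k) \<le> (\<Sum>k=1..N. e k * T k)"
  proof (induction N)
    case (Suc N)
    have "T (Suc N) * (\<Sum>k=1..N. e k) \<le> T N * (\<Sum>k=1..N. e k)"
      by (cases "N = 0") (use e[of N] assms in \<open>auto intro!: mult_right_mono\<close>)
    then show ?case using Suc by (simp add: algebra_simps)
  qed auto
  moreover have "T N * (\<Sum>k=1..N. e k) \<ge> 0" using e assms by simp
  moreover have "(\<Sum>k=1..N. e k * T k) = (\<Sum>k\<in>{1..N} \<inter> divisor_sparse. T k) - 3 / 16 * (\<Sum>k=1..N. T k)"
  proof -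
    have "(\<Sum>k=1..N. e k * T k) = (\<Sum>k=1..N. (if k \<in> divisor_sparse then T k else 0) - 3 / 16 * T k)"
      by (intro sum.cong refl) (simp add: e_def algebra_simps)
    then show ?thesis
      by (simp only: sum_subtractf sum_distrib_left sum.inter_restrict[OF finite_atLeastAtMost])
  qed
  ultimately show ?thesis by linarith
qed

subsection \<open>Translation averages and distance to the integers\<close>

lemma emeasure_lborel_translate:
  fixes S :: "'a::euclidean_space set"
  assumes "S \<in> sets borel"
  shows "emeasure lborel {x. x + a \<in> S} = emeasure lborel S"
proof -
  have "emeasure lborel S = emeasure (distr lborel borel ((+) a)) S"
    by (simp add: lborel_distr_plus)
  also have "\<dots> = emeasure lborel {x. x + a \<in> S}"
    using assms by (subst emeasure_distr) (auto simp: vimage_def add.commute)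
  finally show ?thesis by simp
qed

lemma borel_measurable_vec_nth [measurable (raw)]:
  fixes f :: "'a \<Rightarrow> real ^ 'n::finite"
  shows "f \<in> borel_measurable M \<Longrightarrow> (\<lambda>x. f x $ k) \<in> borel_measurable M"
  by (rule measurable_compose[where N = borel]) (auto intro!: borel_measurable_continuous_onI continuous_intros)

lemma emeasure_lborel_vec_box:
  fixes S :: "'n::finite \<Rightarrow> real set"
  assumes [measurable]: "\<And>k. S k \<in> sets borel"
  shows "emeasure lborel {x::real^'n. \<forall>k. x $ k \<in> S k} = (\<Prod>k\<in>UNIV. emeasure lborel (S k))"
proof -
  \<comment> \<open>The product formula for \<open>lborel\<close> runs over basis vectors;
    \<open>idx\<close> recovers the coordinate that belongs to a basis vector.\<close>
  define idx where "idx b = (THE k. b = (axis k 1 :: real^'n))" for b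
  have idx: "idx (axis k 1) = k" for k
    unfolding idx_def by (rule the_equality) (auto simp: axis_eq_axis)
  have inj: "inj (\<lambda>k. axis k 1 :: real^'n)" by (auto simp: inj_def axis_eq_axis)
  have B: "(Basis :: (real^'n) set) = range (\<lambda>k. axis k 1)" by (auto simp: Basis_vec_def)
  have "emeasure lborel {x::real^'n. \<forall>k. x $ k \<in> S k}
      = (\<integral>\<^sup>+x. indicator {x::real^'n. \<forall>k. x $ k \<in> S k} x \<partial>lborel)"
    by (rule nn_integral_indicator[symmetric]) measurable
  also have "\<dots> = (\<integral>\<^sup>+x. (\<Prod>b\<in>Basis. indicator (S (idx b)) (x \<bullet> b)) \<partial>(lborel :: (real^'n) measure))"
  proof (intro nn_integral_cong)
    fix x :: "real^'n"
    show "indicator {x::real^'n. \<forall>k. x $ k \<in> S k} x = (\<Prod>b\<in>Basis. indicator (S (idx b)) (x \<bullet> b) :: ennreal)"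
      unfolding B by (subst prod.reindex[OF inj])
        (auto simp: idx cart_eq_inner_axis indicator_def prod_zero_iff intro!: prod.neutral)
  qed
  also have "\<dots> = (\<Prod>b\<in>Basis. \<integral>\<^sup>+x. indicator (S (idx b)) x \<partial>lborel)"
    by (intro nn_integral_lborel_prod) auto
  also have "\<dots> = (\<Prod>k\<in>UNIV. emeasure lborel (S k))"
    unfolding B by (subst prod.reindex[OF inj]) (simp add: idx)
  finally show ?thesis .
qed

lemma emeasure_periodic:
  fixes Y :: "real set"
  assumes [measurable]: "Y \<in> sets borel" and per: "\<And>x. x + 1 \<in> Y \<longleftrightarrow> x \<in> Y"
  shows "emeasure lborel (Y \<inter> {c..<c + 1}) = emeasure lborel (Y \<inter> {0..<1})"
proof -
  have pn: "x + real n \<in> Y \<longleftrightarrow> x \<in> Y" for x n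
  proof (induction n)
    case (Suc n)
    have "x + real (Suc n) = (x + real n) + 1" by simp
    then show ?case using Suc by (simp only: per)
  qed simp
  have pz: "x + of_int z \<in> Y \<longleftrightarrow> x \<in> Y" for x z
  proof (cases "z \<ge> 0")
    case True
    then show ?thesis using pn[of x "nat z"] by simp
  next
    case False
    then show ?thesis using pn[of "x + of_int z" "nat (- z)"] by simp
  qed
  \<comment> \<open>Cut at the integer \<open>n\<close> in [c, c + 1): the left piece, translated by
    n - 1, and the right piece, translated by n, together tile [0, 1).\<close>
  define n where "n = \<lceil>c\<rceil>"
  have n: "c \<le> of_int n" "of_int n < c + 1" unfolding n_def by linarith+
  have "emeasure lborel (Y \<inter> {c..<c + 1})
      = emeasure lborel (Y \<inter> {c..<of_int n}) + emeasure lborel (Y \<inter> {of_int n..<c + 1})"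
    using n by (subst plus_emeasure) (auto intro!: arg_cong[where f = "emeasure lborel"])
  also have "emeasure lborel (Y \<inter> {c..<of_int n}) = emeasure lborel {x. x + of_int (n - 1) \<in> Y \<inter> {c..<of_int n}}"
    by (intro emeasure_lborel_translate[symmetric]) measurable
  also have "{x. x + of_int (n - 1) \<in> Y \<inter> {c..<of_int n}} = Y \<inter> {c + 1 - of_int n..<1}"
    unfolding Int_iff pz by auto
  also have "emeasure lborel (Y \<inter> {of_int n..<c + 1}) = emeasure lborel {x. x + of_int n \<in> Y \<inter> {of_int n..<c + 1}}"
    by (intro emeasure_lborel_translate[symmetric]) measurable
  also have "{x. x + of_int n \<in> Y \<inter> {of_int n..<c + 1}} = Y \<inter> {0..<c + 1 - of_int n}"
    unfolding Int_iff pz by auto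
  also have "emeasure lborel (Y \<inter> {c + 1 - of_int n..<1}) + emeasure lborel (Y \<inter> {0..<c + 1 - of_int n})
     = emeasure lborel (Y \<inter> {0..<1})"
    using n by (subst plus_emeasure) (auto intro!: arg_cong[where f = "emeasure lborel"])
  finally show ?thesis .
qed

text \<open>Averaging over a small family of translations reduces measure estimates for subsets of a large
  space to estimates, uniform in \<open>v\<close>, in the few parameters \<open>s\<close>.\<close>

lemma emeasure_shift_average:
  fixes w :: "'b::euclidean_space \<Rightarrow> 'a::euclidean_space"
  assumes [measurable]: "S \<in> sets borel" "X \<in> sets borel" "w \<in> borel_measurable borel"
  shows "emeasure lborel S * emeasure lborel X = (\<integral>\<^sup>+v. emeasure lborel {s\<in>S. v + w s \<in> X} \<partial>lborel)"
proof -
  define Z where "Z = {z\<in>space (lborel \<Otimes>\<^sub>M lborel). snd z \<in> S \<and> fst z + w (snd z) \<in> X}"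
  have [measurable]: "Z \<in> sets (lborel \<Otimes>\<^sub>M lborel)" unfolding Z_def by measurable
  have "emeasure lborel S * emeasure lborel X = (\<integral>\<^sup>+s. indicator S s * emeasure lborel X \<partial>lborel)"
    by (simp add: nn_integral_multc)
  also have "\<dots> = (\<integral>\<^sup>+s. emeasure lborel ((\<lambda>v. (v, s)) -` Z) \<partial>lborel)"
  proof (intro nn_integral_cong)
    fix s :: 'b
    show "indicator S s * emeasure lborel X = emeasure lborel ((\<lambda>v. (v, s)) -` Z)"
      using emeasure_lborel_translate[of X "w s"]
      by (auto simp: Z_def space_pair_measure vimage_def split: split_indicator)
  qed
  also have "\<dots> = emeasure (lborel \<Otimes>\<^sub>M lborel) Z" by (rule lborel_pair.emeasure_pair_measure_alt2[symmetric]) measurable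
  also have "\<dots> = (\<integral>\<^sup>+v. emeasure lborel (Pair v -` Z) \<partial>lborel)"
    by (rule lborel.emeasure_pair_measure_alt) measurable
  also have "\<dots> = (\<integral>\<^sup>+v. emeasure lborel {s\<in>S. v + w s \<in> X} \<partial>lborel)"
    by (simp add: Z_def space_pair_measure vimage_def)
  finally show ?thesis .
qed

section \<open>Points close to an integer along a line\<close>

definition near_int :: "real \<Rightarrow> real set" where
  "near_int r = {x. \<exists>p::int. \<bar>x + p\<bar> \<le> r}"

lemma near_int_borel [measurable]: "near_int r \<in> sets borel"
  unfolding near_int_def by measurable

lemma near_int_add_1: "x + 1 \<in> near_int r \<longleftrightarrow> x \<in> near_int r"
proof
  assume "x + 1 \<in> near_int r"
  then obtain p :: int where "\<bar>x + 1 + p\<bar> \<le> r" by (auto simp: near_int_def)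
  then have "\<bar>x + of_int (p + 1)\<bar> \<le> r" by (simp add: add_ac)
  then show "x \<in> near_int r" unfolding near_int_def by blast
next
  assume "x \<in> near_int r"
  then obtain p :: int where "\<bar>x + p\<bar> \<le> r" by (auto simp: near_int_def)
  then have "\<bar>x + 1 + of_int (p - 1)\<bar> \<le> r" by (simp add: add_ac)
  then show "x + 1 \<in> near_int r" unfolding near_int_def by blast
qed

lemma emeasure_affine_band:
  fixes d :: real
  assumes "d \<noteq> 0" "r \<ge> 0"
  shows "emeasure lborel {s. \<bar>z + s * d\<bar> \<le> r} = ennreal (2 * r / \<bar>d\<bar>)"
proof -
  have "{s. \<bar>z + s * d\<bar> \<le> r} = {- z / d - r / \<bar>d\<bar>..- z / d + r / \<bar>d\<bar>}"
  proof (rule set_eqI)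
    fix s
    have "\<bar>z + s * d\<bar> \<le> r \<longleftrightarrow> \<bar>z / d + s\<bar> * \<bar>d\<bar> \<le> r"
      using assms by (simp add: abs_mult[symmetric] ring_distribs)
    also have "\<dots> \<longleftrightarrow> \<bar>z / d + s\<bar> \<le> r / \<bar>d\<bar>" using assms by (simp add: pos_le_divide_eq)
    also have "\<dots> \<longleftrightarrow> s \<in> {- z / d - r / \<bar>d\<bar>..- z / d + r / \<bar>d\<bar>}" by auto
    finally show "s \<in> {s. \<bar>z + s * d\<bar> \<le> r} \<longleftrightarrow> s \<in> {- z / d - r / \<bar>d\<bar>..- z / d + r / \<bar>d\<bar>}" by simp
  qed
  then show ?thesis using assms by simp
qed

text \<open>The value z + s d sweeps an interval of length |d|. For small r at most |d| + 3 \<le>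
  4|d| integers p are relevant, each giving a band of length 2r/|d|, hence at most 8r altogether.
  The constant 10 makes the case r \<ge> 1/10 trivial.\<close>

lemma emeasure_near_int_le:
  fixes d :: int
  assumes "d \<noteq> 0" "r \<ge> 0"
  shows "emeasure lborel {s\<in>{0..<1::real}. z + s * d \<in> near_int r} \<le> ennreal (10 * r)"
proof (cases "r \<ge> 1 / 10")
  case True
  have "emeasure lborel {s\<in>{0..<1::real}. z + s * d \<in> near_int r} \<le> emeasure lborel {0..<1::real}"
    by (intro emeasure_mono) auto
  also have "\<dots> \<le> ennreal (10 * r)" using True by (simp add: ennreal_leI flip: ennreal_1)
  finally show ?thesis .
next
  case False
  \<comment> \<open>The midpoint of the range of -(z + s d), followed by half its length, enlarged
    by 1 to absorb r.\<close>
  define m where "m = - z - d / 2"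
  define h where "h = \<bar>real_of_int d\<bar> / 2 + 1"
  define Q where "Q = {\<lceil>m - h\<rceil>..\<lfloor>m + h\<rfloor>}"
  have "{s\<in>{0..<1::real}. z + s * d \<in> near_int r} \<subseteq> (\<Union>p\<in>Q. {s::real. \<bar>(z + real_of_int p) + s * real_of_int d\<bar> \<le> r})"
  proof
    fix s assume s: "s \<in> {s\<in>{0..<1::real}. z + s * d \<in> near_int r}"
    then obtain p :: int where p: "\<bar>z + s * d + p\<bar> \<le> r" by (auto simp: near_int_def)
    have "\<bar>s * d - d / 2\<bar> \<le> \<bar>real_of_int d\<bar> / 2"
    proof -
      have "\<bar>s * d - d / 2\<bar> = \<bar>s - 1 / 2\<bar> * \<bar>real_of_int d\<bar>"
        by (simp add: abs_mult[symmetric] ring_distribs)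
      also have "\<dots> \<le> 1 / 2 * \<bar>real_of_int d\<bar>" using s by (intro mult_right_mono) (unfold abs_le_iff, auto)
      finally show ?thesis by simp
    qed
    then have "\<bar>of_int p - m\<bar> \<le> h" using p False unfolding m_def h_def by linarith
    then have "p \<in> Q" unfolding Q_def by (auto simp: ceiling_le_iff le_floor_iff)
    then show "s \<in> (\<Union>p\<in>Q. {s::real. \<bar>(z + real_of_int p) + s * real_of_int d\<bar> \<le> r})"
      using p by (auto simp: algebra_simps)
  qed
  then have "emeasure lborel {s\<in>{0..<1::real}. z + s * d \<in> near_int r}
      \<le> emeasure lborel (\<Union>p\<in>Q. {s::real. \<bar>(z + real_of_int p) + s * real_of_int d\<bar> \<le> r})"
    by (intro emeasure_mono) (auto simp: Q_def)
  also have "\<dots> \<le> (\<Sum>p\<in>Q. emeasure lborel {s::real. \<bar>(z + real_of_int p) + s * real_of_int d\<bar> \<le> r})"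
    by (intro emeasure_subadditive_finite) (auto simp: Q_def)
  also have "\<dots> = (\<Sum>p\<in>Q. ennreal (2 * r / \<bar>real_of_int d\<bar>))"
    using assms by (intro sum.cong refl emeasure_affine_band) auto
  also have "\<dots> = ennreal (real (card Q) * (2 * r / \<bar>real_of_int d\<bar>))"
    using assms by (subst sum_ennreal) auto
  also have "\<dots> \<le> ennreal (10 * r)"
  proof (rule ennreal_leI)
    have "real (card Q) \<le> 2 * h + 1"
      unfolding Q_def by (simp add: h_def) linarith
    also have "\<dots> \<le> 4 * \<bar>real_of_int d\<bar>"
    proof -
      have "1 \<le> \<bar>real_of_int d\<bar>" using assms(1) by linarith
      then show ?thesis by (simp add: h_def)
    qed
    finally have "real (card Q) * (2 * r / \<bar>real_of_int d\<bar>) \<le> 4 * \<bar>real_of_int d\<bar> * (2 * r / \<bar>real_of_int d\<bar>)"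
      using assms by (intro mult_right_mono) auto
    then show "real (card Q) * (2 * r / \<bar>real_of_int d\<bar>) \<le> 10 * r" using assms by simp
  qed
  finally show ?thesis .
qed

text \<open>The value z + s a sweeps length a\<rho>, so at least a\<rho>/10 integers coprime to
  \<open>a\<close> yield a band inside the range. The bands have length 2r/a and are disjoint
  because r \<le> 1/4, for a total of \<rho>r/5. The threshold depends on \<rho> alone, hence is
  uniform in z and r.\<close>

lemma emeasure_near_int_coprime_ge:
  assumes "0 < \<rho>"
  obtains M where "\<And>a r z. a \<in> divisor_sparse \<Longrightarrow> a \<ge> M \<Longrightarrow> 0 \<le> r \<Longrightarrow> r \<le> 1 / 4 \<Longrightarrow>
    ennreal (\<rho> * r / 5) \<le> emeasure lborel {s\<in>{0..\<rho>}. \<exists>p::int. coprime (int a) p \<and> \<bar>z + s * a + p\<bar> \<le> r}"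
proof
  \<comment> \<open>This \<open>t\<close> makes a/t at most a\<rho>/20, and \<open>M\<close> makes
    a\<rho> at least 20(t + 1). Together they leave at least a\<rho>/10 of the main term, which is
    roughly a\<rho>/5.\<close>
  define t where "t = nat \<lceil>20 / \<rho>\<rceil>"
  define M where "M = nat \<lceil>20 * (real t + 1) / \<rho>\<rceil>"
  fix a :: nat and r z :: real
  assume a: "a \<in> divisor_sparse" "a \<ge> M" and r: "0 \<le> r" "r \<le> 1 / 4"
  have a0: "a > 0" using a by (simp add: divisor_sparse_def)
  have t: "real t \<ge> 20 / \<rho>" unfolding t_def by linarith
  then have t0: "t > 0" using assms by (metis divide_pos_pos less_le_trans of_nat_0_less_iff zero_less_numeral)
  have "real a \<ge> 20 * (real t + 1) / \<rho>" using a(2) unfolding M_def by linarith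
  then have aM: "real a * \<rho> \<ge> 20 * (real t + 1)" using assms by (simp add: pos_divide_le_eq)
  have aM': "20 * real t + 20 \<le> real a * \<rho>" using aM by (simp add: algebra_simps)
  \<comment> \<open>The integers in (A, A + L] fill the range of -(z + s a) up to a margin at both
    ends. The margin keeps each band of radius r, and not only its centre, within 0 \<le> s \<le>
    \<rho>.\<close>
  define A where "A = \<lceil>- z - a * \<rho>\<rceil>"
  define L where "L = nat \<lfloor>a * \<rho> - 2\<rfloor>"
  have L: "real L \<ge> a * \<rho> - 3" unfolding L_def by linarith
  have L2: "real L \<le> a * \<rho> - 2" proof -
    have "20 * (real t + 1) \<ge> 2" by simp
    then have "a * \<rho> - 2 \<ge> 0" using aM by simp
    then have "real L = of_int \<lfloor>a * \<rho> - 2\<rfloor>" unfolding L_def by simp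
    then show ?thesis by linarith
  qed
  define Q where "Q = {x\<in>{A<..A + int L}. coprime (int a) x}"
  have fQ: "finite Q" unfolding Q_def by (rule finite_subset[of _ "{A<..A + int L}"]) auto
  define J where "J p = {s::real. \<bar>(z + real_of_int p) + s * real a\<bar> \<le> r}" for p :: int
  have [measurable]: "J p \<in> sets borel" for p unfolding J_def by measurable
  have at: "real a / real t \<le> real a * \<rho> / 20"
    using t t0 assms a0 by (simp add: field_simps)
  have cQ: "real (card Q) \<ge> a * \<rho> / 10"
    proof -
    define y where "y = real a * \<rho>"
    show ?thesis
      using card_coprime_interval_ge[OF a(1) t0, of L A] L aM' at
      unfolding Q_def y_def[symmetric] by linarith
  qed
  have "ennreal (\<rho> * r / 5) \<le> ennreal (real (card Q) * (2 * r / \<bar>real a\<bar>))"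
  proof (rule ennreal_leI)
    have "real a * \<rho> / 10 * (2 * r / \<bar>real a\<bar>) \<le> real (card Q) * (2 * r / \<bar>real a\<bar>)"
      using cQ r by (intro mult_right_mono) auto
    then show "\<rho> * r / 5 \<le> real (card Q) * (2 * r / \<bar>real a\<bar>)" using a0 by simp
  qed
  also have "\<dots> = (\<Sum>p\<in>Q. ennreal (2 * r / \<bar>real a\<bar>))"
    using r by (subst sum_ennreal) auto
  also have "\<dots> = (\<Sum>p\<in>Q. emeasure lborel (J p))"
    unfolding J_def using a0 r by (intro sum.cong refl emeasure_affine_band[symmetric]) auto
  also have "\<dots> = emeasure lborel (\<Union>p\<in>Q. J p)"
  proof (rule sum_emeasure)
    show "disjoint_family_on J Q"
      unfolding disjoint_family_on_def
    proof (intro ballI impI)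
      fix p q :: int assume "p \<noteq> q"
      then have "\<bar>real_of_int p - real_of_int q\<bar> \<ge> 1" by linarith
      then show "J p \<inter> J q = {}" using r unfolding J_def by auto
    qed
  qed (use fQ in auto)
  also have "\<dots> \<le> emeasure lborel {s\<in>{0..\<rho>}. \<exists>p::int. coprime (int a) p \<and> \<bar>z + s * a + p\<bar> \<le> r}"
  proof (rule emeasure_mono)
    show "(\<Union>p\<in>Q. J p) \<subseteq> {s\<in>{0..\<rho>}. \<exists>p::int. coprime (int a) p \<and> \<bar>z + s * a + p\<bar> \<le> r}"
    proof
      fix s assume "s \<in> (\<Union>p\<in>Q. J p)"
      then obtain p where p: "p \<in> Q" "s \<in> J p" by auto
      have "real_of_int p \<ge> of_int A + 1" "real_of_int p \<le> of_int A + L" using p unfolding Q_def by auto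
      moreover have "of_int A \<ge> - z - a * \<rho>" "of_int A < - z - a * \<rho> + 1" unfolding A_def by linarith+
      ultimately have "s * a \<ge> 0" "s * a \<le> a * \<rho>"
        using p r L2 unfolding J_def by auto
      then have "s \<in> {0..\<rho>}" using a0 by (auto simp: zero_le_mult_iff mult.commute)
      then show "s \<in> {s\<in>{0..\<rho>}. \<exists>p::int. coprime (int a) p \<and> \<bar>z + s * a + p\<bar> \<le> r}"
        using p unfolding Q_def J_def by (auto simp: add_ac)
    qed
  qed measurable
  finally show "ennreal (\<rho> * r / 5) \<le> emeasure lborel {s\<in>{0..\<rho>}. \<exists>p::int. coprime (int a) p \<and> \<bar>z + s * a + p\<bar> \<le> r}" .
qed

definition unit_cube :: "(real ^ 'n) set" where
  "unit_cube = {x. \<forall>k. x $ k \<in> {0..<1}}"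

lemma unit_cube_borel [measurable]: "unit_cube \<in> sets borel"
  unfolding unit_cube_def by measurable

lemma emeasure_unit_cube: "emeasure lborel (unit_cube :: (real ^ 'n::finite) set) = 1"
  unfolding unit_cube_def by (subst emeasure_lborel_vec_box) auto

lemma emeasure_near_int_vec_le:
  fixes d :: int and z :: "real ^ 'n::finite"
  assumes "d \<noteq> 0" "r \<ge> 0"
  shows "emeasure lborel {s\<in>unit_cube. \<forall>k. z $ k + s $ k * d \<in> near_int r} \<le> ennreal ((10 * r) ^ CARD('n))"
proof -
  have "{s\<in>unit_cube. \<forall>k. z $ k + s $ k * d \<in> near_int r} =
      {s. \<forall>k. s $ k \<in> {s\<in>{0..<1::real}. z $ k + s * d \<in> near_int r}}"
    by (auto simp: unit_cube_def)
  also have "emeasure lborel \<dots> = (\<Prod>k\<in>UNIV. emeasure lborel {s\<in>{0..<1::real}. z $ k + s * d \<in> near_int r})"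
    by (rule emeasure_lborel_vec_box) measurable
  also have "\<dots> \<le> (\<Prod>k\<in>(UNIV::'n set). ennreal (10 * r))"
    by (intro prod_mono_ennreal emeasure_near_int_le assms)
  also have "\<dots> = ennreal ((10 * r) ^ CARD('n))" using assms by (simp add: ennreal_power)
  finally show ?thesis .
qed

text \<open>Source of the quasi-independence: \<open>s\<close> perturbs one column of \<Theta>,
  \<open>t\<close> perturbs y, and \<open>a\<close>, \<open>a'\<close> are the matching entries of
  two integer vectors. Parallel vectors are allowed, because (a, -1) and (a', -1) are independent as
  soon as a and a' differ.\<close>

lemma emeasure_near_int_pair_le:
  fixes a a' :: int and u u' :: "real ^ 'n::finite"
  assumes "a \<noteq> a'" "r \<ge> 0" "r' \<ge> 0"
  shows "emeasure lborel {(s, t). s \<in> unit_cube \<and> t \<in> unit_cube \<and>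
       (\<forall>k. u $ k + s $ k * a - t $ k \<in> near_int r) \<and> (\<forall>k. u' $ k + s $ k * a' - t $ k \<in> near_int r')}
    \<le> ennreal ((10 * r) ^ CARD('n) * (10 * r') ^ CARD('n))"
    (is "emeasure lborel ?Z \<le> _")
proof -
  have [measurable]: "?Z \<in> sets (lborel \<Otimes>\<^sub>M lborel)" proof -
    have "{x \<in> space (lborel \<Otimes>\<^sub>M lborel). fst x \<in> unit_cube \<and> snd x \<in> unit_cube \<and>
       (\<forall>k. u $ k + fst x $ k * a - snd x $ k \<in> near_int r) \<and> (\<forall>k. u' $ k + fst x $ k * a' - snd x $ k \<in> near_int r')}
       \<in> sets (lborel \<Otimes>\<^sub>M lborel)" by measurable
    then show ?thesis by (simp add: space_pair_measure split_beta')
  qed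
  define W :: "((real^'n) \<times> (real^'n)) set" where "W = {(s, t). s \<in> unit_cube \<and> t \<in> unit_cube \<and>
       (\<forall>k. - t $ k \<in> near_int r) \<and> (\<forall>k. (u' - u) $ k - t $ k + s $ k * of_int (a' - a) \<in> near_int r')}"
  have [measurable]: "W \<in> sets (lborel \<Otimes>\<^sub>M lborel)" proof -
    have "{x \<in> space (lborel \<Otimes>\<^sub>M lborel). fst x \<in> unit_cube \<and> snd x \<in> unit_cube \<and>
       (\<forall>k. - snd x $ k \<in> near_int r) \<and> (\<forall>k. (u' - u) $ k - snd x $ k + fst x $ k * of_int (a' - a) \<in> near_int r')}
       \<in> sets (lborel \<Otimes>\<^sub>M lborel)" by measurable
    then show ?thesis by (simp add: W_def space_pair_measure split_beta')
  qed
  \<comment> \<open>By periodicity, \<open>t\<close> may be translated by \<open>u + a s\<close>; then \<open>s\<close> occurs in one condition only, with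
    the nonzero integer coefficient \<open>a' - a\<close>.\<close>
  have slice: "emeasure lborel (Pair s -` ?Z) = emeasure lborel (Pair s -` W)" for s
  proof (cases "s \<in> unit_cube")
    case True
    define c where "c k = u $ k + s $ k * a" for k
    define Y where "Y k = {t. - t \<in> near_int r \<and> (u' - u) $ k - t + s $ k * of_int (a' - a) \<in> near_int r'}" for k
    have [measurable]: "Y k \<in> sets borel" for k unfolding Y_def by measurable
    have Y1: "t + 1 \<in> Y k \<longleftrightarrow> t \<in> Y k" for t k
    proof -
      have "- (t + 1) + 1 = - t"
        "(u' - u) $ k - (t + 1) + s $ k * of_int (a' - a) + 1 = (u' - u) $ k - t + s $ k * of_int (a' - a)" by simp_all
      then show ?thesis
        using near_int_add_1[of "- (t + 1)" r] near_int_add_1[of "(u' - u) $ k - (t + 1) + s $ k * of_int (a' - a)" r']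
        by (simp only: Y_def mem_Collect_eq)
    qed
    have YZ: "t - c k \<in> Y k \<longleftrightarrow> u $ k + s $ k * a - t \<in> near_int r \<and> u' $ k + s $ k * a' - t \<in> near_int r'" for t k
      by (simp add: Y_def c_def algebra_simps)
    have "Pair s -` ?Z = {t. \<forall>k. t $ k \<in> {t\<in>{0..<1::real}. t - c k \<in> Y k}}"
      unfolding mem_Collect_eq YZ using True by (auto simp: unit_cube_def)
    also have "emeasure lborel \<dots> = (\<Prod>k\<in>UNIV. emeasure lborel {t\<in>{0..<1::real}. t - c k \<in> Y k})"
      by (rule emeasure_lborel_vec_box) measurable
    also have "\<dots> = (\<Prod>k\<in>UNIV. emeasure lborel (Y k \<inter> {0..<1}))"
    proof (intro prod.cong refl)
      fix k
      have "{t\<in>{0..<1::real}. t - c k \<in> Y k} = {t. t + (- c k) \<in> Y k \<inter> {- c k..<- c k + 1}}" by auto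
      then have "emeasure lborel {t\<in>{0..<1::real}. t - c k \<in> Y k} = emeasure lborel (Y k \<inter> {- c k..<- c k + 1})"
        by (simp only:) (rule emeasure_lborel_translate, measurable)
      also have "\<dots> = emeasure lborel (Y k \<inter> {0..<1})" by (rule emeasure_periodic) (auto simp: Y1)
      finally show "emeasure lborel {t\<in>{0..<1::real}. t - c k \<in> Y k} = emeasure lborel (Y k \<inter> {0..<1})" .
    qed
    also have "\<dots> = emeasure lborel {t::real^'n. \<forall>k. t $ k \<in> Y k \<inter> {0..<1}}"
      by (rule emeasure_lborel_vec_box[symmetric]) measurable
    also have "{t::real^'n. \<forall>k. t $ k \<in> Y k \<inter> {0..<1}} = Pair s -` W"
      using True by (auto simp: W_def Y_def unit_cube_def)
    finally show ?thesis .
  qed (auto simp: W_def)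
  have "emeasure lborel ?Z = emeasure (lborel \<Otimes>\<^sub>M lborel) ?Z" by (simp add: lborel_prod)
  also have "\<dots> = (\<integral>\<^sup>+s. emeasure lborel (Pair s -` ?Z) \<partial>lborel)"
    by (rule lborel.emeasure_pair_measure_alt) measurable
  also have "\<dots> = (\<integral>\<^sup>+s. emeasure lborel (Pair s -` W) \<partial>lborel)" by (simp only: slice)
  also have "\<dots> = emeasure (lborel \<Otimes>\<^sub>M lborel) W" by (rule lborel.emeasure_pair_measure_alt[symmetric]) measurable
  \<comment> \<open>Now integrate over \<open>s\<close> first. For every \<open>t\<close> the
    condition on \<open>s\<close> costs (10 r')^n, and the remaining condition on \<open>t\<close>
    alone costs (10 r)^n, by the same bound with z = 0 and d = -1.\<close>
  also have "\<dots> = (\<integral>\<^sup>+t. emeasure lborel ((\<lambda>s. (s, t)) -` W) \<partial>lborel)"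
    by (rule lborel_pair.emeasure_pair_measure_alt2) measurable
  also have "\<dots> \<le> (\<integral>\<^sup>+t. ennreal ((10 * r') ^ CARD('n)) *
      indicator {t\<in>unit_cube. \<forall>k. (0::real^'n) $ k + t $ k * of_int (- 1) \<in> near_int r} t \<partial>lborel)"
  proof (intro nn_integral_mono)
    fix t :: "real^'n"
    have "emeasure lborel ((\<lambda>s. (s, t)) -` W)
       \<le> emeasure lborel {s\<in>unit_cube. \<forall>k. ((u' - u) - t) $ k + s $ k * of_int (a' - a) \<in> near_int r'}"
      by (intro emeasure_mono) (auto simp: W_def)
    also have "\<dots> \<le> ennreal ((10 * r') ^ CARD('n))"
      using assms by (intro emeasure_near_int_vec_le) auto
    finally show "emeasure lborel ((\<lambda>s. (s, t)) -` W) \<le> ennreal ((10 * r') ^ CARD('n)) *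
      indicator {t\<in>unit_cube. \<forall>k. (0::real^'n) $ k + t $ k * of_int (- 1) \<in> near_int r} t"
    proof (cases "t \<in> unit_cube \<and> (\<forall>k. - t $ k \<in> near_int r)")
      case False
      then have "(\<lambda>s. (s, t)) -` W = {}" by (auto simp: W_def)
      then show ?thesis by simp
    qed auto
  qed
  also have "\<dots> = ennreal ((10 * r') ^ CARD('n)) *
      emeasure lborel {t\<in>unit_cube. \<forall>k. (0::real^'n) $ k + t $ k * of_int (- 1) \<in> near_int r}"
    by (subst nn_integral_cmult_indicator) auto
  also have "\<dots> \<le> ennreal ((10 * r') ^ CARD('n)) * ennreal ((10 * r) ^ CARD('n))"
    using assms by (intro mult_left_mono emeasure_near_int_vec_le) auto
  also have "\<dots> = ennreal ((10 * r) ^ CARD('n) * (10 * r') ^ CARD('n))"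
    using assms by (simp add: ennreal_mult' mult.commute)
  finally show ?thesis .
qed

subsection \<open>Approximation sets\<close>

definition residual :: "int ^ 'm \<Rightarrow> (real ^ 'm ^ 'n) \<times> (real ^ 'n) \<Rightarrow> real ^ 'n" where
  "residual q v = fst v *v real_vec q - snd v"

definition approx_set :: "int ^ 'm \<Rightarrow> real \<Rightarrow> ((real ^ 'm ^ 'n) \<times> (real ^ 'n)) set" where
  "approx_set q r = {v. \<exists>p. infnorm (residual q v + real_vec p) \<le> r}"

definition coprime_approx_set ::
    "'m \<Rightarrow> 'n \<Rightarrow> int ^ 'm \<Rightarrow> real \<Rightarrow> ((real ^ 'm ^ 'n) \<times> (real ^ 'n)) set" where
  "coprime_approx_set i l q r =
     {v. \<exists>p. coprime (q $ i) (p $ l) \<and> infnorm (residual q v + real_vec p) \<le> r}"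

text \<open>Adding this matrix to \<Theta> changes \<Theta>q by q_i s; these are the translations
  over which measures are averaged.\<close>

definition column_shift :: "'m \<Rightarrow> real ^ 'n \<Rightarrow> real ^ 'm ^ 'n" where
  "column_shift i s = (\<chi> k j. if j = i then s $ k else 0)"

lemma infnorm_vec_le_iff: "infnorm (x :: real ^ 'n) \<le> r \<longleftrightarrow> (\<forall>k. \<bar>x $ k\<bar> \<le> r)"
proof
  assume "\<forall>k. \<bar>x $ k\<bar> \<le> r"
  then show "infnorm x \<le> r" unfolding infnorm_cart by (intro cSup_least) auto
qed (use component_le_infnorm_cart order_trans in blast)

lemma approx_set_eq:
  "approx_set q r = {v :: (real ^ 'm ^ 'n) \<times> (real ^ 'n). \<forall>k. residual q v $ k \<in> near_int r}"
proof (intro set_eqI iffI)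
  fix v :: "(real ^ 'm ^ 'n) \<times> (real ^ 'n)"
  assume "v \<in> approx_set q r"
  then show "v \<in> {v. \<forall>k. residual q v $ k \<in> near_int r}"
    by (auto simp: approx_set_def near_int_def infnorm_vec_le_iff real_vec_def)
next
  fix v :: "(real ^ 'm ^ 'n) \<times> (real ^ 'n)"
  assume "v \<in> {v. \<forall>k. residual q v $ k \<in> near_int r}"
  then obtain p :: "'n \<Rightarrow> int" where p: "\<And>k. \<bar>residual q v $ k + p k\<bar> \<le> r"
    unfolding near_int_def mem_Collect_eq by metis
  then have "infnorm (residual q v + real_vec (\<chi> k. p k)) \<le> r"
    by (auto simp: infnorm_vec_le_iff real_vec_def)
  then show "v \<in> approx_set q r" unfolding approx_set_def by blast
qed

lemma residual_linear: "linear (residual q)"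
  by (rule linearI)
     (simp_all add: residual_def matrix_vector_mult_add_rdistrib scaleR_matrix_vector_assoc algebra_simps)

lemma residual_borel [measurable]: "residual q \<in> borel_measurable borel"
  by (intro borel_measurable_continuous_onI linear_continuous_on)
     (simp add: residual_linear flip: linear_conv_bounded_linear)

lemma infnorm_borel [measurable]: "(infnorm :: real ^ 'n \<Rightarrow> real) \<in> borel_measurable borel"
  by (intro borel_measurable_continuous_onI continuous_on_infnorm continuous_on_id)

lemma approx_set_borel [measurable]: "approx_set q r \<in> sets borel"
  unfolding approx_set_def by measurable

lemma coprime_approx_set_borel [measurable]: "coprime_approx_set i l q r \<in> sets borel"
  unfolding coprime_approx_set_def by measurable

lemma coprime_approx_set_subset: "coprime_approx_set i l q r \<subseteq> approx_set q r"
  unfolding coprime_approx_set_def approx_set_def by blast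

lemma column_shift_linear: "linear (column_shift i)"
  by (rule linearI) (simp_all add: column_shift_def vec_eq_iff)

lemma column_shift_mult: "(column_shift i s *v x) $ k = s $ k * x $ i"
  by (simp add: column_shift_def matrix_vector_mult_def if_distrib[of "\<lambda>a. a * _"] cong: if_cong)

lemma residual_add: "residual q (v + w) = residual q v + residual q w"
  by (rule linear_add[OF residual_linear])

lemma residual_shift: "residual q (column_shift i s, t) $ k = s $ k * of_int (q $ i) - t $ k"
  by (simp add: residual_def column_shift_mult real_vec_def)

lemma unit_cube_bounded: "bounded (unit_cube :: (real ^ 'n) set)"
  by (rule bounded_subset[OF bounded_cbox[of 0 "\<chi> k. 1"]])
     (auto simp: unit_cube_def mem_box_cart less_imp_le)

section \<open>Upper and lower measure bounds for the approximation sets\<close>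

text \<open>By averaging, the measure of \<open>X\<close> is the integral over v of the measure of
  parameters that move v into \<open>X\<close>. The integrand is at most \<open>c\<close> and
  vanishes unless |v| \<le> R + B.\<close>

lemma emeasure_le_of_shift:
  fixes w :: "'b::euclidean_space \<Rightarrow> 'a::euclidean_space"
  assumes [measurable]: "S \<in> sets borel" "X \<in> sets borel" "w \<in> borel_measurable borel"
    and "emeasure lborel S = 1" "X \<subseteq> cball 0 R" "\<And>s. s \<in> S \<Longrightarrow> norm (w s) \<le> B"
    and le: "\<And>v. emeasure lborel {s\<in>S. v + w s \<in> X} \<le> c"
  shows "emeasure lborel X \<le> c * emeasure lborel (cball 0 (R + B) :: 'a set)"
proof -
  have "emeasure lborel X = (\<integral>\<^sup>+v. emeasure lborel {s\<in>S. v + w s \<in> X} \<partial>lborel)"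
    using emeasure_shift_average[of S X w] assms by simp
  also have "\<dots> \<le> (\<integral>\<^sup>+v. c * indicator (cball 0 (R + B) :: 'a set) v \<partial>lborel)"
  proof (intro nn_integral_mono)
    fix v :: 'a
    show "emeasure lborel {s\<in>S. v + w s \<in> X} \<le> c * indicator (cball 0 (R + B)) v"
    proof (cases "v \<in> cball 0 (R + B)")
      case False
      have "{s\<in>S. v + w s \<in> X} = {}"
      proof (intro equals0I)
        fix s assume s: "s \<in> {s\<in>S. v + w s \<in> X}"
        then have "norm (v + w s) \<le> R" "norm (w s) \<le> B" using assms by auto
        moreover have "norm v \<le> norm (v + w s) + norm (w s)"
          using norm_triangle_ineq4[of "v + w s" "w s"] by simp
        ultimately show False using False by simp
      qed
      then show ?thesis by (simp only: emeasure_empty zero_le)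
    qed (use le in auto)
  qed
  also have "\<dots> = c * emeasure lborel (cball 0 (R + B) :: 'a set)" by (simp add: nn_integral_cmult_indicator)
  finally show ?thesis .
qed

text \<open>The constant depends on \<open>R\<close> and the dimensions, but not on the integer
  vectors or radii. For one vector it suffices to shift y, so q = 0 is allowed. For two vectors,
  shift y together with a column in which they differ.\<close>

lemma approx_set_upper_bounds:
  fixes R :: real
  obtains C :: real where "C > 0"
    and "\<And>(q :: int ^ 'm::finite) r. r \<ge> 0 \<Longrightarrow>
        emeasure lborel (cball 0 R \<inter> approx_set q r :: ((real ^ 'm ^ 'n::finite) \<times> (real ^ 'n)) set)
          \<le> ennreal (C * r ^ CARD('n))"
    and "\<And>(q :: int ^ 'm) q' r r'. q \<noteq> q' \<Longrightarrow> r \<ge> 0 \<Longrightarrow> r' \<ge> 0 \<Longrightarrow>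
        emeasure lborel (cball 0 R \<inter> approx_set q r \<inter> approx_set q' r' :: ((real ^ 'm ^ 'n) \<times> (real ^ 'n)) set)
          \<le> ennreal (C * (r ^ CARD('n) * r' ^ CARD('n)))"
proof -
  define S where "S = (unit_cube \<times> unit_cube :: ((real ^ 'n) \<times> (real ^ 'n)) set)"
  define w where "w i z = ((column_shift i (fst z), snd z) :: (real ^ 'm ^ 'n) \<times> (real ^ 'n))" for i z
  have "linear (w i)" for i
    by (rule linearI) (simp_all add: w_def linear_add[OF column_shift_linear] linear_scale[OF column_shift_linear])
  then have bl: "bounded_linear (w i)" for i by (simp add: linear_conv_bounded_linear)
  then have [measurable]: "w i \<in> borel_measurable borel" for i
    by (intro borel_measurable_continuous_onI linear_continuous_on)
  have "S \<in> sets (lborel \<Otimes>\<^sub>M lborel)" unfolding S_def by measurable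
  then have [measurable]: "S \<in> sets borel" unfolding lborel_prod sets_lborel .
  have "emeasure (lborel \<Otimes>\<^sub>M lborel) S = 1"
    unfolding S_def by (subst lborel.emeasure_pair_measure_Times) (auto simp: emeasure_unit_cube)
  then have S1: "emeasure lborel S = 1" by (simp add: lborel_prod)
  have "bounded S" unfolding S_def by (intro bounded_Times unit_cube_bounded)
  then have "bounded (\<Union>i. w i ` S)"
    by (intro bounded_UN) (auto intro: bounded_linear_image bl)
  then obtain B where B': "\<forall>x\<in>(\<Union>i. w i ` S). norm x \<le> B" unfolding bounded_iff by (elim exE)
  have B: "norm (w i s) \<le> B" if "s \<in> S" for i s
  proof -
    have "w i s \<in> (\<Union>i. w i ` S)" using that by blast
    with B' show ?thesis by (rule bspec)
  qed
  define \<beta> where "\<beta> = measure lborel (cball 0 (R + B) :: ((real ^ 'm ^ 'n) \<times> (real ^ 'n)) set)"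
  have \<beta>: "emeasure lborel (cball 0 (R + B) :: ((real ^ 'm ^ 'n) \<times> (real ^ 'n)) set) = ennreal \<beta>"
    unfolding \<beta>_def using emeasure_bounded_finite[OF bounded_cball] by (intro emeasure_eq_ennreal_measure) (simp only: infinity_ennreal_def less_top)
  have \<beta>0: "\<beta> \<ge> 0" unfolding \<beta>_def by simp
  \<comment> \<open>Two factors 10^n from the pair bound times the volume of the enlarged ball; the
    summand 1 gives positivity at once.\<close>
  define C where "C = 10 ^ CARD('n) * 10 ^ CARD('n) * \<beta> + 1"
  have pair: "emeasure lborel (cball 0 R \<inter> approx_set q r \<inter> approx_set q' r' :: ((real ^ 'm ^ 'n) \<times> (real ^ 'n)) set)
      \<le> ennreal (C * (r ^ CARD('n) * r' ^ CARD('n)))" if "q \<noteq> q'" "r \<ge> 0" "r' \<ge> 0" for q q' :: "int ^ 'm" and r r'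
  proof -
    obtain i where i: "q $ i \<noteq> q' $ i" using \<open>q \<noteq> q'\<close> by (auto simp: vec_eq_iff)
    let ?X = "cball 0 R \<inter> approx_set q r \<inter> approx_set q' r' :: ((real ^ 'm ^ 'n) \<times> (real ^ 'n)) set"
    have "emeasure lborel ?X \<le> ennreal ((10 * r) ^ CARD('n) * (10 * r') ^ CARD('n))
       * emeasure lborel (cball 0 (R + B) :: ((real ^ 'm ^ 'n) \<times> (real ^ 'n)) set)"
    proof (rule emeasure_le_of_shift[where S = S and w = "w i"])
      fix v :: "(real ^ 'm ^ 'n) \<times> (real ^ 'n)"
      let ?Z = "{(s, t). s \<in> unit_cube \<and> t \<in> unit_cube \<and>
          (\<forall>k. residual q v $ k + s $ k * of_int (q $ i) - t $ k \<in> near_int r) \<and>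
          (\<forall>k. residual q' v $ k + s $ k * of_int (q' $ i) - t $ k \<in> near_int r')}"
      have eqZ: "{s\<in>S. v + w i s \<in> approx_set q r \<inter> approx_set q' r'} = ?Z"
        by (auto simp: S_def w_def approx_set_eq residual_add residual_shift add_diff_eq)
      have [measurable]: "{s\<in>S. v + w i s \<in> approx_set q r \<inter> approx_set q' r'} \<in> sets borel" by measurable
      have "emeasure lborel {s\<in>S. v + w i s \<in> ?X} \<le> emeasure lborel {s\<in>S. v + w i s \<in> approx_set q r \<inter> approx_set q' r'}"
        by (rule emeasure_mono) auto
      also have "\<dots> = emeasure lborel ?Z" by (simp only: eqZ)
      also have "\<dots> \<le> ennreal ((10 * r) ^ CARD('n) * (10 * r') ^ CARD('n))"
        using i that by (intro emeasure_near_int_pair_le) auto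
      finally show "emeasure lborel {s\<in>S. v + w i s \<in> ?X} \<le> ennreal ((10 * r) ^ CARD('n) * (10 * r') ^ CARD('n))" .
    qed (use B S1 in auto)
    also have "\<dots> = ennreal ((10 * r) ^ CARD('n) * (10 * r') ^ CARD('n) * \<beta>)"
      unfolding \<beta> using that \<beta>0 by (intro ennreal_mult[symmetric]) auto
    also have "\<dots> \<le> ennreal (C * (r ^ CARD('n) * r' ^ CARD('n)))"
      using that by (intro ennreal_leI) (auto simp: C_def power_mult_distrib algebra_simps)
    finally show ?thesis .
  qed
  have single: "emeasure lborel (cball 0 R \<inter> approx_set q r :: ((real ^ 'm ^ 'n) \<times> (real ^ 'n)) set)
      \<le> ennreal (C * r ^ CARD('n))" if "r \<ge> 0" for q :: "int ^ 'm" and r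
  proof -
    let ?X = "cball 0 R \<inter> approx_set q r :: ((real ^ 'm ^ 'n) \<times> (real ^ 'n)) set"
    have bl': "bounded_linear (\<lambda>t. (0, t) :: (real ^ 'm ^ 'n) \<times> (real ^ 'n))"
      by (intro bounded_linear_Pair bounded_linear_zero bounded_linear_ident)
    have z: "(0::real^'n) \<in> unit_cube" by (simp add: unit_cube_def)
    have "emeasure lborel ?X \<le> ennreal ((10 * r) ^ CARD('n))
       * emeasure lborel (cball 0 (R + B) :: ((real ^ 'm ^ 'n) \<times> (real ^ 'n)) set)"
    proof (rule emeasure_le_of_shift[where S = unit_cube and w = "\<lambda>t. (0, t)"])
      show "(\<lambda>t. (0, t) :: (real ^ 'm ^ 'n) \<times> (real ^ 'n)) \<in> borel_measurable borel"
        by (intro borel_measurable_continuous_onI linear_continuous_on bl')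
      \<comment> \<open>The bound \<open>B\<close> for the joint shifts covers this one: take the
        column perturbation to be 0, at an arbitrary column index.\<close>
      show "norm (0 :: real ^ 'm ^ 'n, t) \<le> B" if "t \<in> unit_cube" for t :: "real ^ 'n"
        using B[of "(0, t)" undefined] that z by (simp add: S_def w_def linear_0[OF column_shift_linear])
      fix v :: "(real ^ 'm ^ 'n) \<times> (real ^ 'n)"
      have "{t\<in>unit_cube. v + (0, t) \<in> ?X}
          \<subseteq> {t\<in>unit_cube. \<forall>k. residual q v $ k + t $ k * of_int (- 1) \<in> near_int r}"
      proof -
        have "residual q (0, t) $ k = - t $ k" for t :: "real ^ 'n" and k
          by (simp add: residual_def matrix_vector_mult_def zero_vec_def)
        then show ?thesis by (auto simp: approx_set_eq residual_add)
      qed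
      then have "emeasure lborel {t\<in>unit_cube. v + (0, t) \<in> ?X}
         \<le> emeasure lborel {t\<in>unit_cube. \<forall>k. residual q v $ k + t $ k * of_int (- 1) \<in> near_int r}"
        by (rule emeasure_mono) measurable
      also have "\<dots> \<le> ennreal ((10 * r) ^ CARD('n))"
        using that by (intro emeasure_near_int_vec_le) auto
      finally show "emeasure lborel {t\<in>unit_cube. v + (0, t) \<in> ?X} \<le> ennreal ((10 * r) ^ CARD('n))" .
    qed (use emeasure_unit_cube in auto)
    also have "\<dots> = ennreal ((10 * r) ^ CARD('n) * \<beta>)"
      unfolding \<beta> using that \<beta>0 by (intro ennreal_mult[symmetric]) auto
    also have "\<dots> \<le> ennreal (C * r ^ CARD('n))"
    proof (rule ennreal_leI)
      have "(10 * r) ^ CARD('n) * \<beta> = 1 * (10 ^ CARD('n) * \<beta> * r ^ CARD('n))" by (simp add: power_mult_distrib)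
      also have "\<dots> \<le> 10 ^ CARD('n) * (10 ^ CARD('n) * \<beta> * r ^ CARD('n))"
        using that \<beta>0 by (intro mult_right_mono) auto
      also have "\<dots> \<le> C * r ^ CARD('n)" using that by (simp add: C_def algebra_simps)
      finally show "(10 * r) ^ CARD('n) * \<beta> \<le> C * r ^ CARD('n)" .
    qed
    finally show ?thesis .
  qed
  have "C > 0" unfolding C_def using \<beta>0 by (intro add_nonneg_pos) auto
  from this single pair show thesis by (rule that)
qed

text \<open>Inner regularity. Compactness puts \<open>K\<close> at positive distance from the
  complement of \<open>U\<close>, which leaves room for small translations of \<open>K\<close>
  inside \<open>U\<close>.\<close>

lemma compact_subset_half_measure:
  fixes U :: "'a::euclidean_space set"
  assumes "open U" "bounded U"
  obtains K where "compact K" "K \<subseteq> U" "emeasure lborel U \<le> 2 * emeasure lborel K"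
proof (cases "emeasure lborel U = 0")
  case True
  then show ?thesis using that[of "{}"] by simp
next
  case False
  have U[measurable]: "U \<in> sets borel" using assms by simp
  have fin: "emeasure lborel U < \<infinity>" using assms emeasure_bounded_finite by blast
  define u where "u = measure lborel U"
  have u: "emeasure lborel U = ennreal u" unfolding u_def using fin by (intro emeasure_eq_ennreal_measure) auto
  have u0: "u > 0" using False u by (metis ennreal_eq_0_iff not_le)
  obtain K where K: "closed K" "K \<subseteq> U" "emeasure lebesgue (U - K) < ennreal (u / 2)"
    using sets_lebesgue_inner_closed[of U "u / 2"] U u0 by (metis half_gt_zero sets_completionI_sets sets_lborel)
  have KB[measurable]: "K \<in> sets borel" using K by simp
  have "compact K" using K assms by (metis bounded_subset compact_eq_bounded_closed)
  have lt: "emeasure lborel (U - K) < ennreal (u / 2)" using K(3) by simp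
  have "emeasure lborel U = emeasure lborel K + emeasure lborel (U - K)"
  proof -
    have "K \<union> (U - K) = U" using K(2) by blast
    then show ?thesis using plus_emeasure[of K lborel "U - K"] by simp
  qed
  moreover define \<kappa> where "\<kappa> = measure lborel K"
  have \<kappa>: "emeasure lborel K = ennreal \<kappa>" unfolding \<kappa>_def
    using fin emeasure_mono[OF K(2), of lborel] by (intro emeasure_eq_ennreal_measure) (auto simp: top_unique less_top)
  ultimately have "ennreal u \<le> ennreal \<kappa> + ennreal (u / 2)" using lt u by (auto intro: add_left_mono less_imp_le)
  moreover have \<kappa>0: "\<kappa> \<ge> 0" unfolding \<kappa>_def by simp
  ultimately have "ennreal u \<le> ennreal (\<kappa> + u / 2)" using u0 by simp
  then have "u \<le> \<kappa> + u / 2" using u0 \<kappa>0 by (subst (asm) ennreal_le_iff) auto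
  then have "ennreal u \<le> ennreal (2 * \<kappa>)" by (intro ennreal_leI) simp
  then have "ennreal u \<le> 2 * ennreal \<kappa>" using \<kappa>0 by (simp add: ennreal_mult')
  then show ?thesis using that[of K] \<open>compact K\<close> K(2) u \<kappa> by simp
qed

text \<open>Translate points of \<open>K\<close> by perturbations of column \<open>i\<close> so
  small that they stay in \<open>U\<close>. For every point of \<open>K\<close>, at least a
  proportion (r/5)^n of the perturbations produces a coprime solution, and averaging turns this into
  a bound for \<open>U\<close>. Only the threshold depends on \<open>U\<close>, not the
  proportion.\<close>

lemma coprime_approx_set_lower_bound:
  fixes U :: "((real ^ 'm::finite ^ 'n::finite) \<times> (real ^ 'n)) set"
  assumes U: "open U" "bounded U"
  obtains M where "\<And>(q :: int ^ 'm) a r. q $ i = int a \<Longrightarrow> a \<in> divisor_sparse \<Longrightarrow> a \<ge> M \<Longrightarrow> 0 \<le> r \<Longrightarrow> r \<le> 1 / 4 \<Longrightarrow>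
    ennreal ((r / 5) ^ CARD('n)) * emeasure lborel U \<le> 2 * emeasure lborel (U \<inter> coprime_approx_set i l q r)"
proof -
  obtain K where K: "compact K" "K \<subseteq> U" "emeasure lborel U \<le> 2 * emeasure lborel K"
    using compact_subset_half_measure[OF U] by blast
  obtain \<epsilon> where \<epsilon>: "\<epsilon> > 0" "(\<Union>x\<in>K. cball x \<epsilon>) \<subseteq> U"
    using compact_subset_open_imp_cball_epsilon_subset[OF K(1) U(1) K(2)] by blast
  define w where "w s = ((column_shift i s, 0) :: (real ^ 'm ^ 'n) \<times> (real ^ 'n))" for s
  have "linear w"
    by (rule linearI) (simp_all add: w_def linear_add[OF column_shift_linear] linear_scale[OF column_shift_linear])
  then have bl: "bounded_linear w" by (simp add: linear_conv_bounded_linear)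
  then have [measurable]: "w \<in> borel_measurable borel"
    by (intro borel_measurable_continuous_onI linear_continuous_on)
  obtain B where B: "B > 0" "\<And>s. norm (w s) \<le> B * norm s" using linear_bounded_pos[OF \<open>linear w\<close>] by blast
  \<comment> \<open>With |s_k| \<le> \<rho> the l1 norm of s is at most n\<rho>, so this choice
    bounds the translation by \<epsilon>.\<close>
  define \<rho> where "\<rho> = \<epsilon> / (B * CARD('n))"
  have \<rho>: "\<rho> > 0" using \<epsilon> B by (simp add: \<rho>_def)
  obtain M where M: "\<And>a r z. a \<in> divisor_sparse \<Longrightarrow> a \<ge> M \<Longrightarrow> 0 \<le> r \<Longrightarrow> r \<le> 1 / 4 \<Longrightarrow>
    ennreal (\<rho> * r / 5) \<le> emeasure lborel {s\<in>{0..\<rho>}. \<exists>p::int. coprime (int a) p \<and> \<bar>z + s * a + p\<bar> \<le> r}"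
    using emeasure_near_int_coprime_ge[OF \<rho>] by blast
  define S where "S = {s::real^'n. \<forall>k. s $ k \<in> {0..\<rho>}}"
  have [measurable]: "S \<in> sets borel" unfolding S_def by measurable
  have S: "emeasure lborel S = ennreal (\<rho> ^ CARD('n))"
    unfolding S_def using \<rho> by (subst emeasure_lborel_vec_box) (auto simp: ennreal_power)
  have wS: "norm (w s) \<le> \<epsilon>" if "s \<in> S" for s
  proof -
    have "norm s \<le> (\<Sum>k\<in>UNIV. \<bar>s $ k\<bar>)" by (rule norm_le_l1_cart)
    also have "\<dots> \<le> (\<Sum>k\<in>(UNIV::'n set). \<rho>)" using that by (intro sum_mono) (auto simp: S_def)
    finally have "norm s \<le> CARD('n) * \<rho>" by simp
    then have "B * norm s \<le> B * (CARD('n) * \<rho>)" using B by (intro mult_left_mono) auto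
    also have "\<dots> = \<epsilon>" using B by (simp add: \<rho>_def)
    finally show ?thesis using B(2)[of s] by linarith
  qed
  have UB[measurable]: "U \<in> sets borel" "K \<in> sets borel" using U K by (auto simp: compact_imp_closed)
  show thesis
  proof (rule that)
    fix q :: "int ^ 'm" and a :: nat and r :: real
    assume a: "q $ i = int a" "a \<in> divisor_sparse" "a \<ge> M" and r: "0 \<le> r" "r \<le> 1 / 4"
    define X where "X = U \<inter> coprime_approx_set i l q r"
    have [measurable]: "X \<in> sets borel" unfolding X_def by measurable
    have "ennreal ((\<rho> * r / 5) ^ CARD('n)) * emeasure lborel K
        = (\<integral>\<^sup>+v. ennreal ((\<rho> * r / 5) ^ CARD('n)) * indicator K v \<partial>lborel)"
      by (simp add: nn_integral_cmult_indicator)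
    also have "\<dots> \<le> (\<integral>\<^sup>+v. emeasure lborel {s\<in>S. v + w s \<in> X} \<partial>lborel)"
    proof (intro nn_integral_mono)
      fix v
      show "ennreal ((\<rho> * r / 5) ^ CARD('n)) * indicator K v \<le> emeasure lborel {s\<in>S. v + w s \<in> X}"
      proof (cases "v \<in> K")
        case True
        \<comment> \<open>All coordinates are treated alike, each p_k being made coprime to
          \<open>a\<close>, so that the good perturbations contain a box.\<close>
        define J where "J k = {s\<in>{0..\<rho>}. \<exists>p::int. coprime (int a) p \<and> \<bar>residual q v $ k + s * a + p\<bar> \<le> r}" for k
        have [measurable]: "J k \<in> sets borel" for k unfolding J_def by measurable
        have "ennreal ((\<rho> * r / 5) ^ CARD('n)) = (\<Prod>k\<in>(UNIV::'n set). ennreal (\<rho> * r / 5))"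
          using \<rho> r by (simp add: ennreal_power)
        also have "\<dots> \<le> (\<Prod>k\<in>UNIV. emeasure lborel (J k))"
          unfolding J_def by (intro prod_mono_ennreal M a r)
        also have "\<dots> = emeasure lborel {s::real^'n. \<forall>k. s $ k \<in> J k}"
          by (rule emeasure_lborel_vec_box[symmetric]) measurable
        also have "\<dots> \<le> emeasure lborel {s\<in>S. v + w s \<in> X}"
        proof (rule emeasure_mono)
          show "{s. \<forall>k. s $ k \<in> J k} \<subseteq> {s\<in>S. v + w s \<in> X}"
          proof
            fix s assume s: "s \<in> {s. \<forall>k. s $ k \<in> J k}"
            then have sS: "s \<in> S" by (auto simp: S_def J_def)
            have "v + w s \<in> U" using \<epsilon>(2) True wS[OF sS] by (force simp: dist_norm)
            moreover have "\<exists>p. \<forall>k. coprime (int a) (p k) \<and> \<bar>residual q v $ k + s $ k * a + of_int (p k)\<bar> \<le> r"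
              using s unfolding J_def mem_Collect_eq by metis
            then obtain p where p: "\<And>k. coprime (int a) (p k)" "\<And>k. \<bar>residual q v $ k + s $ k * a + of_int (p k)\<bar> \<le> r"
              by blast
            have "infnorm (residual q (v + w s) + real_vec (\<chi> k. p k)) \<le> r"
              using p(2) a by (simp add: infnorm_vec_le_iff residual_add w_def residual_shift real_vec_def add.assoc)
            then have "v + w s \<in> coprime_approx_set i l q r"
              using p(1) a unfolding coprime_approx_set_def by (auto intro!: exI[of _ "\<chi> k. p k"])
            ultimately show "s \<in> {s\<in>S. v + w s \<in> X}" using sS by (simp add: X_def)
          qed
        qed measurable
        finally show ?thesis using True by simp
      qed simp
    qed
    also have "\<dots> = emeasure lborel S * emeasure lborel X" by (rule emeasure_shift_average[symmetric]) measurable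
    finally have "ennreal (\<rho> ^ CARD('n)) * (ennreal ((r / 5) ^ CARD('n)) * emeasure lborel K)
        \<le> ennreal (\<rho> ^ CARD('n)) * emeasure lborel X"
      using \<rho> r unfolding S
      by (simp add: power_mult_distrib power_divide ennreal_mult'[symmetric] mult.assoc[symmetric])
    then have *: "ennreal ((r / 5) ^ CARD('n)) * emeasure lborel K \<le> emeasure lborel X"
      using \<rho> by (subst (asm) ennreal_mult_le_mult_iff) auto
    have "ennreal ((r / 5) ^ CARD('n)) * emeasure lborel U \<le> ennreal ((r / 5) ^ CARD('n)) * (2 * emeasure lborel K)"
      by (intro mult_left_mono K) auto
    also have "\<dots> \<le> 2 * emeasure lborel X" using mult_left_mono[OF *, of 2] by (simp add: mult_ac)
    finally show "ennreal ((r / 5) ^ CARD('n)) * emeasure lborel U \<le> 2 * emeasure lborel (U \<inter> coprime_approx_set i l q r)"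
      unfolding X_def .
  qed
qed

subsection \<open>Quasi-independence\<close>

text \<open>Suppose \<open>E\<close> has measure e > 0 and take an open U \<supseteq> E with |U - E|
  \<le> \<epsilon>. For a finite family of total weight S, the counting function N of the
  \<open>A i\<close> has integral at least c S e over U - E, while its second moment is at most 2 C
  S^2. Since N \<le> L S + N^2 / (L S), this gives c e \<le> L \<epsilon> + 2 C / L, which fails for
  L large and then \<epsilon> small.\<close>

lemma quasi_independent_avoid_null:
  fixes A A' :: "'i \<Rightarrow> 'a::euclidean_space set" and w :: "'i \<Rightarrow> real"
  assumes [measurable]: "\<And>i. A i \<in> sets borel" "\<And>i. A' i \<in> sets borel" "E \<in> sets borel"
    and sub: "\<And>i. A' i \<subseteq> A i" and ER: "E \<subseteq> ball 0 R"
    and avoid: "\<And>i. i \<in> I \<Longrightarrow> E \<inter> A' i = {}"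
    and w0: "\<And>i. w i \<ge> 0" and C: "C > 0" and c: "c > 0"
    and single: "\<And>i. i \<in> I \<Longrightarrow> measure lborel (cball 0 R \<inter> A i) \<le> C * w i"
    and pair: "\<And>i j. i \<in> I \<Longrightarrow> j \<in> I \<Longrightarrow> i \<noteq> j \<Longrightarrow> measure lborel (cball 0 R \<inter> A i \<inter> A j) \<le> C * (w i * w j)"
    and lower: "\<And>U. open U \<Longrightarrow> bounded U \<Longrightarrow> \<exists>J. finite J \<and>
       (\<forall>i\<in>I - J. c * w i * measure lborel U \<le> measure lborel (U \<inter> A' i))"
    and diverge: "\<And>J b. finite J \<Longrightarrow> \<exists>F. finite F \<and> F \<subseteq> I - J \<and> b \<le> sum w F"
  shows "emeasure lborel E = 0"
proof (rule ccontr)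
  assume "emeasure lborel E \<noteq> 0"
  have mfin: "emeasure lborel X \<noteq> \<infinity>" if "X \<subseteq> cball 0 R" for X :: "'a set"
    using emeasure_bounded_finite[OF bounded_subset[OF bounded_cball that]] by simp
  have EC: "E \<subseteq> cball 0 R" using ER ball_subset_cball by blast
  define e where "e = measure lborel E"
  have "emeasure lborel E = ennreal e"
    unfolding e_def using mfin[OF EC] by (intro emeasure_eq_ennreal_measure) auto
  then have e: "e > 0" using \<open>emeasure lborel E \<noteq> 0\<close> by (metis ennreal_eq_0_iff not_le)
  have key: "c * e \<le> L * \<epsilon> + 2 * C / L" if L: "L > 0" and eps: "\<epsilon> > 0" for L \<epsilon> :: real
  proof -
    have "E \<in> sets lebesgue" by simp
    then obtain T where T: "open T" "E \<subseteq> T" "emeasure lebesgue (T - E) < ennreal \<epsilon>"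
      using sets_lebesgue_outer_open[OF _ eps] by metis
    define U where "U = T \<inter> ball 0 R"
    have oU: "open U" "bounded U" "E \<subseteq> U" "U \<subseteq> cball 0 R" using T ER by (auto simp: U_def)
    have [measurable]: "U \<in> sets borel" "T \<in> sets borel" using oU T by auto
    have "emeasure lborel (U - E) \<le> emeasure lborel (T - E)" by (intro emeasure_mono) (auto simp: U_def)
    also have "\<dots> < ennreal \<epsilon>" using T(3) by simp
    finally have "measure lborel (U - E) \<le> \<epsilon>"
      using eps unfolding measure_def by (metis enn2real_leI less_imp_le)
    then have UE: "measure lborel (U - E) \<le> \<epsilon>" .
    obtain J where J: "finite J" "\<And>i. i \<in> I - J \<Longrightarrow> c * w i * measure lborel U \<le> measure lborel (U \<inter> A' i)"
      using lower[OF oU(1,2)] by blast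
    \<comment> \<open>Total weight at least 1 lets the diagonal contribution C S be absorbed into C
      S^2.\<close>
    obtain F where F: "finite F" "F \<subseteq> I - J" "1 \<le> sum w F" using diverge[OF J(1)] by blast
    define S where "S = sum w F"
    have S: "S \<ge> 1" using F by (simp add: S_def)
    define K where "K = (cball 0 R :: 'a set)"
    have [measurable]: "K \<in> sets borel" by (simp add: K_def)
    have mK: "emeasure lborel (X \<inter> Y) < \<infinity>" if "X \<subseteq> K" for X Y
      using mfin[of "X \<inter> Y"] that by (auto simp: K_def less_top)
    have UK: "U - E \<subseteq> K" using oU by (auto simp: K_def)
    have int: "integrable lborel (indicator (X \<inter> Y) :: 'a \<Rightarrow> real)" if "X \<subseteq> K" "X \<in> sets borel" "Y \<in> sets borel" for X Y
      using mK[OF that(1)] that by (intro integrable_real_indicator) auto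
    have iUE: "integrable lborel (indicator (U - E) :: 'a \<Rightarrow> real)" using int[OF UK, of UNIV] by simp
    have eq: "(\<integral>v. indicator (X \<inter> Y) v \<partial>lborel) = measure lborel (X \<inter> Y)" for X Y :: "'a set"
      by simp
    have "S * (c * e) \<le> S * (c * measure lborel U)"
      unfolding e_def using S c oU mfin by (intro mult_left_mono measure_mono_fmeasurable) (auto simp: fmeasurable_def less_top)
    also have "\<dots> = (\<Sum>i\<in>F. c * w i * measure lborel U)"
      by (simp add: S_def sum_distrib_right sum_distrib_left mult_ac)
    also have "\<dots> \<le> (\<Sum>i\<in>F. measure lborel ((U - E) \<inter> A i))"
    proof (intro sum_mono)
      fix i assume i: "i \<in> F"
      have "c * w i * measure lborel U \<le> measure lborel (U \<inter> A' i)" using J i F by blast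
      \<comment> \<open>Since \<open>E\<close> misses \<open>A' i\<close>, the part of
        \<open>A' i\<close> in \<open>U\<close> lies in \<open>U - E\<close>.\<close>
      also have "\<dots> \<le> measure lborel ((U - E) \<inter> A i)"
        using avoid[of i] sub[of i] i F mK[OF UK]
        by (intro measure_mono_fmeasurable) (auto simp: fmeasurable_def)
      finally show "c * w i * measure lborel U \<le> measure lborel ((U - E) \<inter> A i)" .
    qed
    also have "\<dots> = (\<integral>v. (\<Sum>i\<in>F. indicator ((U - E) \<inter> A i) v) \<partial>lborel)"
      by (subst Bochner_Integration.integral_sum) (auto simp only: eq intro!: int UK, measurable)
    also have "\<dots> \<le> (\<integral>v. L * S * indicator ((U - E) \<inter> UNIV) v
        + (\<Sum>i\<in>F. \<Sum>j\<in>F. indicator (K \<inter> (A i \<inter> A j)) v) / (L * S) \<partial>lborel)"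
    proof (rule integral_mono)
      fix v
      define N where "N = (\<Sum>i\<in>F. indicator (A i) v :: real)"
      have N0: "N \<ge> 0" unfolding N_def by (intro sum_nonneg) auto
      have LS: "L * S > 0" using L S by simp
      show "(\<Sum>i\<in>F. indicator ((U - E) \<inter> A i) v) \<le> L * S * indicator ((U - E) \<inter> UNIV) v
        + (\<Sum>i\<in>F. \<Sum>j\<in>F. indicator (K \<inter> (A i \<inter> A j)) v) / (L * S)"
      proof (cases "v \<in> U - E")
        case True
        have "(\<Sum>i\<in>F. \<Sum>j\<in>F. indicator (K \<inter> (A i \<inter> A j)) v) = N * N"
          unfolding N_def sum_product using True UK
          by (intro sum.cong refl) (auto split: split_indicator)
        moreover have "(\<Sum>i\<in>F. indicator ((U - E) \<inter> A i) v) = N"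
          unfolding N_def using True by (intro sum.cong refl) (auto split: split_indicator)
        \<comment> \<open>replaces the Cauchy--Schwarz inequality\<close>
        moreover have "N \<le> L * S + N * N / (L * S)"
        proof (cases "N \<le> L * S")
          case False
          then have "N * (L * S) \<le> N * N" using N0 by (intro mult_left_mono) auto
          then have "N \<le> N * N / (L * S)" using LS by (simp add: pos_le_divide_eq)
          then show ?thesis using LS by linarith
        qed (use N0 LS in \<open>simp add: add_increasing2\<close>)
        ultimately show ?thesis using True by simp
      next
        case False
        then have "(\<Sum>i\<in>F. indicator ((U - E) \<inter> A i) v) = (0::real)" by (intro sum.neutral) auto
        then show ?thesis using LS by (auto intro!: add_nonneg_nonneg divide_nonneg_pos sum_nonneg)
      qed
    qed (auto intro!: int UK Bochner_Integration.integrable_sum Bochner_Integration.integrable_add iUE simp: K_def)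
    also have "\<dots> = L * S * measure lborel ((U - E) \<inter> UNIV)
        + (\<Sum>i\<in>F. \<Sum>j\<in>F. measure lborel (K \<inter> (A i \<inter> A j))) / (L * S)"
    proof -
      have i1: "integrable lborel (\<lambda>v. L * S * indicator ((U - E) \<inter> UNIV) v)"
        by (intro integrable_mult_right int UK) auto
      have i2: "integrable lborel (\<lambda>v. \<Sum>i\<in>F. \<Sum>j\<in>F. indicator (K \<inter> (A i \<inter> A j)) v :: real)"
        by (intro Bochner_Integration.integrable_sum int) auto
      have "(\<integral>v. (\<Sum>i\<in>F. \<Sum>j\<in>F. indicator (K \<inter> (A i \<inter> A j)) v :: real) \<partial>lborel)
          = (\<Sum>i\<in>F. \<Sum>j\<in>F. measure lborel (K \<inter> (A i \<inter> A j)))"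
        by (subst Bochner_Integration.integral_sum, (intro Bochner_Integration.integrable_sum int; auto),
            intro sum.cong refl, subst Bochner_Integration.integral_sum, (intro int; auto), simp only: eq)
      then show ?thesis
        using i1 i2 by (simp only: Bochner_Integration.integral_add[OF i1 integrable_divide[OF i2]]
            integral_mult_right_zero integral_divide_zero eq)
    qed
    \<comment> \<open>On the diagonal only the single-set bound C w_i is available, which accounts
      for the extra term.\<close>
    also have "\<dots> \<le> L * S * \<epsilon> + (\<Sum>i\<in>F. \<Sum>j\<in>F. C * (w i * w j) + (if i = j then C * w i else 0)) / (L * S)"
    proof (intro add_mono mult_left_mono divide_right_mono sum_mono)
      fix i j assume ij: "i \<in> F" "j \<in> F"
      show "measure lborel (K \<inter> (A i \<inter> A j)) \<le> C * (w i * w j) + (if i = j then C * w i else 0)"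
      proof (cases "i = j")
        case True
        have "i \<in> I" using ij F by auto
        then have "measure lborel (K \<inter> A i) \<le> C * w i" using single by (simp add: K_def)
        moreover have "C * (w i * w i) \<ge> 0" using C by simp
        ultimately show ?thesis using True by simp
      next
        case False
        then show ?thesis using pair[of i j] ij F by (auto simp: K_def Int_assoc)
      qed
    qed (use UE L S in auto)
    also have "(\<Sum>i\<in>F. \<Sum>j\<in>F. C * (w i * w j) + (if i = j then C * w i else 0)) = C * (S * S) + C * S"
    proof -
      have "(\<Sum>i\<in>F. \<Sum>j\<in>F. C * (w i * w j)) = C * (S * S)"
        unfolding S_def sum_product by (simp only: sum_distrib_left)
      moreover have "(\<Sum>i\<in>F. C * w i) = C * S" unfolding S_def by (rule sum_distrib_left[symmetric])
      ultimately show ?thesis using F(1) by (simp add: sum.distrib)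
    qed
    also have "(C * (S * S) + C * S) / (L * S) \<le> (2 * C * S * S) / (L * S)"
    proof (rule divide_right_mono)
      have "C * S * 1 \<le> C * S * S" using S C by (intro mult_left_mono) auto
      then show "C * (S * S) + C * S \<le> 2 * C * S * S" by simp
    qed (use L S in auto)
    finally have "S * (c * e) \<le> L * S * \<epsilon> + (2 * C * S * S) / (L * S)" by simp
    also have "\<dots> = S * (L * \<epsilon> + 2 * C / L)" using S L by (simp add: field_simps)
    finally show ?thesis using S by simp
  qed
  \<comment> \<open>This choice makes 2 C / L = c e / 2, and \<epsilon> = c e / (4 L) makes L
    \<epsilon> = c e / 4; together they give only 3/4 of c e.\<close>
  define L where "L = 4 * C / (c * e)"
  have L: "L > 0" using C c e by (simp add: L_def)
  have "c * e \<le> L * (c * e / (4 * L)) + 2 * C / L" using L c e by (intro key) auto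
  also have "\<dots> = 3 / 4 * (c * e)" using L C c e by (simp add: L_def field_simps)
  finally show False using c e by simp
qed

subsection \<open>Counting integer vectors\<close>

lemma finite_vec_box:
  assumes "\<And>j. finite (S j)"
  shows "finite {q :: 'a ^ 'm. \<forall>j. q $ j \<in> S j}"
    and "card {q :: 'a ^ 'm. \<forall>j. q $ j \<in> S j} = (\<Prod>j\<in>UNIV. card (S j))"
proof -
  have "bij_betw vec_lambda (PiE UNIV S) {q :: 'a ^ 'm. \<forall>j. q $ j \<in> S j}"
    by (rule bij_betw_byWitness[where f' = vec_nth]) (auto simp: PiE_UNIV_domain)
  then show "finite {q :: 'a ^ 'm. \<forall>j. q $ j \<in> S j}"
    "card {q :: 'a ^ 'm. \<forall>j. q $ j \<in> S j} = (\<Prod>j\<in>UNIV. card (S j))"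
    using assms by (auto simp: card_PiE finite_PiE dest: bij_betw_same_card bij_betw_finite)
qed

lemma int_supnorm_le_iff: "int_supnorm q \<le> b \<longleftrightarrow> (\<forall>i. \<bar>q $ i\<bar> \<le> int b)"
  unfolding int_supnorm_def by (subst Max_le_iff) (auto simp: nat_le_iff)

lemma int_supnorm_attained: "\<exists>i. \<bar>q $ i\<bar> = int (int_supnorm q)"
proof -
  have "int_supnorm q \<in> range (\<lambda>i. nat \<bar>q $ i\<bar>)" unfolding int_supnorm_def by (intro Max_in) auto
  then show ?thesis by auto
qed

lemma int_supnorm_eq_0_iff: "int_supnorm q = 0 \<longleftrightarrow> q = 0"
  using int_supnorm_le_iff[of q 0] by (auto simp: vec_eq_iff)

lemma finite_int_shell: "finite {q :: int ^ 'm. int_supnorm q = k}"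
  by (rule finite_subset[OF _ finite_vec_box(1)[of "\<lambda>_. {- int k..int k}"]])
     (auto simp: int_supnorm_le_iff abs_le_iff eq_iff[of "int_supnorm _"] minus_le_iff)

text \<open>Some coordinate equals k or -k, and each of the others takes at most 2k + 1 \<le> 3k
  values.\<close>

lemma card_int_shell_le:
  assumes "k \<ge> 1"
  shows "real (card {q :: int ^ 'm::finite. int_supnorm q = k})
    \<le> real (CARD('m)) * 2 * 3 ^ (CARD('m) - 1) * real k ^ (CARD('m) - 1)"
proof -
  define S where "S i j = (if j = i then {int k, - int k} else {- int k..int k})" for i j :: 'm
  have "{q :: int ^ 'm. int_supnorm q = k} \<subseteq> (\<Union>i. {q. \<forall>j. q $ j \<in> S i j})"
  proof
    fix q :: "int ^ 'm" assume "q \<in> {q. int_supnorm q = k}"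
    then have k: "int_supnorm q = k" by simp
    then obtain i where i: "\<bar>q $ i\<bar> = int k" using int_supnorm_attained[of q] by auto
    have "\<bar>q $ j\<bar> \<le> int k" for j using k int_supnorm_le_iff[of q k] by auto
    then have k': "- int k \<le> q $ j" "q $ j \<le> int k" for j by (metis abs_le_iff minus_le_iff)+
    have "q $ i = int k \<or> q $ i = - int k" using i by linarith
    then have "\<forall>j. q $ j \<in> S i j" using k' by (simp add: S_def)
    then show "q \<in> (\<Union>i. {q. \<forall>j. q $ j \<in> S i j})" by blast
  qed
  then have "card {q :: int ^ 'm. int_supnorm q = k} \<le> card (\<Union>i. {q :: int ^ 'm. \<forall>j. q $ j \<in> S i j})"
    by (intro card_mono finite_UN_I finite_vec_box) (auto simp: S_def)
  also have "\<dots> \<le> (\<Sum>i\<in>UNIV. card {q :: int ^ 'm. \<forall>j. q $ j \<in> S i j})" by (rule card_UN_le) simp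
  also have "\<dots> = (\<Sum>i\<in>(UNIV :: 'm set). 2 * (2 * k + 1) ^ (CARD('m) - 1))"
  proof (intro sum.cong refl)
    fix i :: 'm
    have "card {q :: int ^ 'm. \<forall>j. q $ j \<in> S i j} = (\<Prod>j\<in>UNIV. card (S i j))"
      by (rule finite_vec_box) (auto simp: S_def)
    also have "\<dots> = card (S i i) * (\<Prod>j\<in>UNIV - {i}. card (S i j))" by (intro prod.remove) auto
    also have "(\<Prod>j\<in>UNIV - {i}. card (S i j)) = (\<Prod>j\<in>UNIV - {i}. 2 * k + 1)"
      by (intro prod.cong) (auto simp: S_def)
    also have "card (S i i) = 2" using assms by (simp add: S_def)
    finally show "card {q :: int ^ 'm. \<forall>j. q $ j \<in> S i j} = 2 * (2 * k + 1) ^ (CARD('m) - 1)"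
      by (simp add: card_Diff_singleton)
  qed
  also have "\<dots> \<le> CARD('m) * (2 * (3 * k) ^ (CARD('m) - 1))"
  proof -
    have "(2 * k + 1) ^ (CARD('m) - 1) \<le> (3 * k) ^ (CARD('m) - 1)"
      using assms by (intro power_mono) auto
    then show ?thesis by (simp only: sum_constant of_nat_id mult_le_mono2)
  qed
  finally have "card {q :: int ^ 'm. int_supnorm q = k} \<le> CARD('m) * (2 * (3 * k) ^ (CARD('m) - 1))" .
  then have "real (card {q :: int ^ 'm. int_supnorm q = k}) \<le> real (CARD('m) * (2 * (3 * k) ^ (CARD('m) - 1)))"
    by (rule of_nat_mono)
  then show ?thesis by (simp add: power_mult_distrib mult_ac)
qed

text \<open>The interval count with t = 20 leaves k/5 - 20 - k/20, which is at least k/10 exactly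
  when k \<ge> 400.\<close>

lemma card_coprime_below_ge:
  assumes "g \<in> divisor_sparse" "g \<le> k" "400 \<le> k"
  shows "real k / 10 \<le> real (card {x\<in>{1..k}. coprime x g})"
proof -
  have "real k / 5 - 20 - real g / 20 \<le> real (card {x\<in>{0<..0 + int k}. coprime (int g) x})"
    using card_coprime_interval_ge[OF assms(1), of 20 k 0] by simp
  also have "{x\<in>{0<..0 + int k}. coprime (int g) x} = int ` {x\<in>{1..k}. coprime x g}"
  proof (intro equalityI subsetI)
    fix x assume "x \<in> {x\<in>{0<..0 + int k}. coprime (int g) x}"
    then have "x = int (nat x)" "nat x \<in> {x\<in>{1..k}. coprime x g}"
      by (auto simp: coprime_commute simp flip: coprime_int_iff)
    then show "x \<in> int ` {x\<in>{1..k}. coprime x g}" by blast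
  qed (auto simp: coprime_commute)
  also have "card \<dots> = card {x\<in>{1..k}. coprime x g}" by (rule card_image) simp
  finally show ?thesis using assms by simp
qed

text \<open>Each pivot \<open>j \<in> Piv\<close> is to be coprime to its partner \<open>\<sigma> j\<close>; partners are never pivots.\<close>

definition coprime_vecs :: "'m \<Rightarrow> 'm set \<Rightarrow> ('m \<Rightarrow> 'm) \<Rightarrow> nat \<Rightarrow> (int ^ 'm) set" where
  "coprime_vecs i Piv \<sigma> k = {q. q $ i = int k \<and> (\<forall>j. 1 \<le> q $ j \<and> q $ j \<le> int k) \<and>
     (\<forall>j\<in>Piv. coprime (q $ j) (q $ \<sigma> j))}"

lemma int_supnorm_coprime_vecs:
  assumes "q \<in> coprime_vecs i Piv \<sigma> k"
  shows "int_supnorm q = k"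
proof (rule antisym)
  show "int_supnorm q \<le> k" using assms
    by (auto simp: int_supnorm_le_iff coprime_vecs_def abs_le_iff) (metis add_increasing neg_le_0_iff_le of_nat_0_le_iff order_trans zero_le_one minus_le_iff)
  have "\<bar>q $ i\<bar> \<le> int (int_supnorm q)" using int_supnorm_le_iff[of q "int_supnorm q"] by blast
  then show "k \<le> int_supnorm q" using assms by (auto simp: coprime_vecs_def)
qed

lemma finite_coprime_vecs: "finite (coprime_vecs i Piv \<sigma> k)"
  by (rule finite_subset[OF _ finite_int_shell[of k]]) (auto dest: int_supnorm_coprime_vecs)

text \<open>Coordinate \<open>i\<close> is fixed and every other one has at least k/10 choices: a
  non-pivot because \<open>divisor_sparse\<close> has density at least 3/16, a pivot because its
  partner, a non-pivot, is divisor-sparse.\<close>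

lemma card_coprime_vecs_ge:
  fixes i :: "'m::finite"
  assumes i: "i \<notin> Piv" and \<sigma>: "\<And>j. j \<in> Piv \<Longrightarrow> \<sigma> j \<notin> Piv" and k: "k \<in> divisor_sparse" "400 \<le> k"
  shows "(real k / 10) ^ (CARD('m) - 1) \<le> real (card (coprime_vecs i Piv \<sigma> k))"
proof -
  \<comment> \<open>Choose the coordinates outside \<open>Piv\<close> divisor-sparse, then add the pivots one at a time; those
    outside \<open>J\<close>, not yet chosen, are set to \<open>1\<close>.\<close>
  define G where "G J = {f :: 'm \<Rightarrow> nat. f i = k \<and> (\<forall>j. f j \<in> {1..k}) \<and> (\<forall>j\<in>-Piv. f j \<in> divisor_sparse) \<and>
     (\<forall>j\<in>Piv - J. f j = 1) \<and> (\<forall>j\<in>J. coprime (f j) (f (\<sigma> j)))}" for J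
  have fG: "finite (G J)" for J
  proof (rule finite_subset)
    show "G J \<subseteq> PiE UNIV (\<lambda>_. {1..k})" unfolding G_def PiE_UNIV_domain by blast
  qed (simp add: finite_PiE)
  have "(real k / 10) ^ (card (-Piv) - 1 + card J) \<le> real (card (G J))" if "J \<subseteq> Piv" for J
    using finite[of J] that
  proof (induction J rule: finite_induct)
    case empty
    define S where "S j = (if j = i then {k} else if j \<in> Piv then {1} else {x\<in>{1..k}. x \<in> divisor_sparse})" for j
    have "G {} = PiE UNIV S"
      unfolding PiE_UNIV_domain
    proof (intro equalityI subsetI)
      fix f assume "f \<in> G {}"
      then have f: "f i = k" "\<And>j. f j \<in> {1..k}" "\<And>j. j \<notin> Piv \<Longrightarrow> f j \<in> divisor_sparse" "\<And>j. j \<in> Piv \<Longrightarrow> f j = 1"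
        unfolding G_def by blast+
      have "f j \<in> S j" for j using f(1) f(2)[of j] f(3)[of j] f(4)[of j] i by (simp add: S_def)
      then show "f \<in> Pi UNIV S" by simp
    next
      fix f assume f: "f \<in> Pi UNIV S"
      have k1: "1 \<le> k" using k(2) by simp
      have fS: "f j \<in> S j" for j using f by blast
      from fS[of i] have "f i = k" by (simp add: S_def)
      moreover have "f j = 1" if "j \<in> Piv" for j
      proof -
        have "j \<noteq> i" using that i by blast
        then show ?thesis using fS[of j] that by (simp add: S_def)
      qed
      moreover have "f j \<in> {1..k} \<and> f j \<in> divisor_sparse" if "j \<notin> Piv" "j \<noteq> i" for j
        using fS[of j] that by (simp add: S_def)
      moreover have "f j \<in> {1..k}" for j using calculation k1 by (cases "j = i"; cases "j \<in> Piv") auto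
      moreover have "f j \<in> divisor_sparse" if "j \<in> - Piv" for j using calculation that k(1) by (cases "j = i") auto
      ultimately show "f \<in> G {}" unfolding G_def by blast
    qed
    then have "real (card (G {})) = (\<Prod>j\<in>UNIV. real (card (S j)))" by (simp add: card_PiE)
    also have "\<dots> \<ge> (\<Prod>j\<in>UNIV. if j = i \<or> j \<in> Piv then 1 else real k / 10)"
    proof (intro prod_mono conjI)
      fix j
      show "(if j = i \<or> j \<in> Piv then 1 else real k / 10) \<le> real (card (S j))"
        using card_divisor_sparse_ge[of k] i by (auto simp: S_def)
    qed auto
    also have "(\<Prod>j\<in>UNIV. if j = i \<or> j \<in> Piv then 1 else real k / 10) = (real k / 10) ^ card (- Piv - {i})"
    proof -
      have "- {j. j = i \<or> j \<in> Piv} = - Piv - {i}" by auto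
      then show ?thesis by (simp add: prod.If_cases)
    qed
    finally show ?case using i by simp
  next
    case (insert x J)
    define H where "H f = {y\<in>{1..k}. coprime y (f (\<sigma> x))}" for f :: "'m \<Rightarrow> nat"
    have x: "x \<in> Piv" "\<sigma> x \<notin> Piv" "x \<noteq> i" using insert i \<sigma> by auto
    have "(\<lambda>(f, y). f(x := y)) ` Sigma (G J) H \<subseteq> G (insert x J)"
    proof clarify
      fix f y assume fy: "f \<in> G J" "y \<in> H f"
      \<comment> \<open>Changing the value at \<open>x\<close> disturbs no coprimality condition
        through a partner, since partners are never pivots.\<close>
      have "\<sigma> j \<noteq> x" if "j \<in> insert x J" for j using that insert.prems x \<sigma> by blast
      then show "f(x := y) \<in> G (insert x J)"
        using fy x insert.hyps insert.prems unfolding G_def H_def by auto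
    qed
    moreover have "inj_on (\<lambda>(f, y). f(x := y)) (Sigma (G J) H)"
    proof (rule inj_onI, clarify)
      fix f y f' y' assume fy: "f \<in> G J" "f' \<in> G J" and eq: "f(x := y) = f'(x := y')"
      \<comment> \<open>The value overwritten at \<open>x\<close> was the placeholder 1, so the old
        function can be recovered.\<close>
      have "f x = 1" "f' x = 1" using fy x insert.hyps by (auto simp: G_def)
      then have "f j = f' j" for j using fun_cong[OF eq, of j] by (cases "j = x") auto
      then show "f = f' \<and> y = y'" using fun_cong[OF eq, of x] by auto
    qed
    ultimately have "card (Sigma (G J) H) \<le> card (G (insert x J))" by (metis card_image card_mono fG)
    moreover have "card (Sigma (G J) H) = (\<Sum>f\<in>G J. card (H f))"
      by (intro card_SigmaI fG) (auto simp: H_def)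
    ultimately have le: "(\<Sum>f\<in>G J. real (card (H f))) \<le> real (card (G (insert x J)))"
      by (simp flip: of_nat_sum)
    have "(real k / 10) ^ (card (-Piv) - 1 + card (insert x J)) = (real k / 10) ^ (card (-Piv) - 1 + card J) * (real k / 10)"
      using insert.hyps by simp
    also have "\<dots> \<le> real (card (G J)) * (real k / 10)" using insert by (intro mult_right_mono) auto
    also have "\<dots> = (\<Sum>f\<in>G J. real k / 10)" by simp
    also have "\<dots> \<le> (\<Sum>f\<in>G J. real (card (H f)))"
      unfolding H_def using k x by (intro sum_mono card_coprime_below_ge) (auto simp: G_def)
    finally show ?case using le by linarith
  qed
  from this[of Piv] have "(real k / 10) ^ (card (-Piv) - 1 + card Piv) \<le> real (card (G Piv))" by simp
  also have "card (-Piv) - 1 + card Piv = CARD('m) - 1"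
  proof -
    have "card (-Piv) \<ge> 1" using i by (metis Compl_iff One_nat_def Suc_leI card_gt_0_iff empty_iff finite)
    moreover have "card Piv + card (-Piv) = card (Piv \<union> -Piv)"
      by (rule card_Un_disjoint[symmetric]) auto
    ultimately show ?thesis by simp
  qed
  also have "card (G Piv) \<le> card (coprime_vecs i Piv \<sigma> k)"
  proof (rule card_inj_on_le)
    show "inj_on (\<lambda>f. \<chi> j. int (f j)) (G Piv)" by (auto simp: inj_on_def vec_eq_iff)
    show "(\<lambda>f. \<chi> j. int (f j)) ` G Piv \<subseteq> coprime_vecs i Piv \<sigma> k"
      by (auto simp: G_def coprime_vecs_def Suc_le_eq)
    show "finite (coprime_vecs i Piv \<sigma> k)"
      by (rule finite_coprime_vecs)
  qed
  finally show ?thesis by simp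
qed

section \<open>Coprimality of pairs that forces membership in \<open>P\<close>\<close>

text \<open>A component with fewer than two of the first m indices has exactly one of them, by its
  size, and then all n last indices. By disjointness there is at most one such component, and it
  supplies \<open>i\<close> and \<open>l\<close>. Every other component contains two of the first m
  indices, a pivot and its partner. One coprime pair per component already makes the gcd equal to
  1.\<close>

lemma partition_pivots:
  fixes \<pi> :: "('m::finite + 'n::finite) set set"
  assumes part: "partition_on UNIV \<pi>" and big: "\<forall>B\<in>\<pi>. card B \<ge> CARD('n) + 1"
  obtains i :: 'm and l :: 'n and Piv \<sigma> where "i \<notin> Piv" "\<And>j. j \<in> Piv \<Longrightarrow> \<sigma> j \<notin> Piv"
    "\<And>q p. coprime (q $ i) (p $ l) \<Longrightarrow> (\<forall>j\<in>Piv. coprime (q $ j) (q $ \<sigma> j)) \<Longrightarrow> stack q p \<in> P \<pi>"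
proof -
  have disj: "B = B'" if "B \<in> \<pi>" "B' \<in> \<pi>" "x \<in> B" "x \<in> B'" for B B' x
    using part that by (auto simp: partition_on_def disjoint_def)
  define L where "L B = {i :: 'm. Inl i \<in> B}" for B :: "('m + 'n) set"
  define R where "R B = {l :: 'n. Inr l \<in> B}" for B :: "('m + 'n) set"
  have card: "card B = card (L B) + card (R B)" for B
  proof -
    have "B = Inl ` L B \<union> Inr ` R B"
    proof (rule set_eqI)
      show "x \<in> B \<longleftrightarrow> x \<in> Inl ` L B \<union> Inr ` R B" for x by (cases x) (auto simp: L_def R_def)
    qed
    then have "card B = card (Inl ` L B \<union> Inr ` R B)" by simp
    also have "\<dots> = card (L B) + card (R B)" by (subst card_Un_disjoint) (auto simp: card_image)
    finally show ?thesis .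
  qed
  have R_le: "card (R B) \<le> CARD('n)" for B by (simp add: card_mono)
  obtain i l where il: "\<And>B. B \<in> \<pi> \<Longrightarrow> card (L B) \<ge> 2 \<or> (Inl i \<in> B \<and> Inr l \<in> B)"
  proof (cases "\<exists>B\<in>\<pi>. card (L B) < 2")
    case True
    then obtain B where B: "B \<in> \<pi>" "card (L B) < 2" by blast
    have "card (R B) = CARD('n)" "card (L B) = 1" using big B card[of B] R_le[of B] by auto
    then have RB: "R B = UNIV" and "card (L B) = 1" by (simp_all add: card_eq_UNIV_imp_eq_UNIV)
    then obtain i where i: "L B = {i}" by (auto simp: card_1_singleton_iff)
    \<comment> \<open>Any value serves for \<open>l\<close>, because \<open>B\<close> contains all
      of the last n indices.\<close>
    show ?thesis
    proof (rule that[of i undefined])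
      fix B' assume B': "B' \<in> \<pi>"
      show "card (L B') \<ge> 2 \<or> (Inl i \<in> B' \<and> Inr undefined \<in> B')"
      proof (cases "B' = B")
        case True
        then show ?thesis using i RB by (auto simp: L_def R_def)
      next
        case False
        then have "R B' = {}" using disj[OF B' B(1)] RB by (auto simp: R_def)
        then have "card (L B') \<ge> CARD('n) + 1" using bspec[OF big B'] card[of B'] by simp
        moreover have "CARD('n) > 0" by simp
        ultimately show ?thesis by linarith
      qed
    qed
  next
    case False
    then show ?thesis using that[of undefined undefined] by fastforce
  qed
  define \<pi>2 where "\<pi>2 = {B\<in>\<pi>. card (L B) \<ge> 2}"
  \<comment> \<open>Of two distinct members at least one differs from \<open>i\<close>; it becomes
    the pivot. The partner may be \<open>i\<close> itself.\<close>
  have "\<exists>a b. a \<in> L B \<and> b \<in> L B \<and> a \<noteq> i \<and> a \<noteq> b" if "B \<in> \<pi>2" for B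
  proof -
    obtain x y where xy: "x \<in> L B" "y \<in> L B" "x \<noteq> y"
    proof -
      have "\<not> card (L B) \<le> Suc 0" using \<open>B \<in> \<pi>2\<close> by (simp add: \<pi>2_def)
      then have "\<exists>x\<in>L B. \<exists>y\<in>L B. x \<noteq> y" by (subst (asm) card_le_Suc0_iff_eq) auto
      then show thesis using that by blast
    qed
    then show ?thesis by (cases "x = i") blast+
  qed
  then obtain pv pt where pvt: "\<And>B. B \<in> \<pi>2 \<Longrightarrow> pv B \<in> L B \<and> pt B \<in> L B \<and> pv B \<noteq> i \<and> pv B \<noteq> pt B"
    by metis
  have inj: "inj_on pv \<pi>2"
  proof (rule inj_onI)
    fix B B' assume B: "B \<in> \<pi>2" "B' \<in> \<pi>2" "pv B = pv B'"
    then have "Inl (pv B) \<in> B" "Inl (pv B) \<in> B'" using pvt[OF B(1)] pvt[OF B(2)] by (auto simp: L_def)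
    then show "B = B'" using disj[of B B'] B by (auto simp: \<pi>2_def)
  qed
  define \<sigma> where "\<sigma> = pt \<circ> inv_into \<pi>2 pv"
  have \<sigma>: "\<sigma> (pv B) = pt B" if "B \<in> \<pi>2" for B using inj that by (simp add: \<sigma>_def)
  show thesis
  proof (rule that[of i "pv ` \<pi>2" \<sigma> l])
    show "i \<notin> pv ` \<pi>2" using pvt by blast
    show "\<sigma> j \<notin> pv ` \<pi>2" if j: "j \<in> pv ` \<pi>2" for j
    proof
      assume "\<sigma> j \<in> pv ` \<pi>2"
      then obtain B' where B': "B' \<in> \<pi>2" "\<sigma> j = pv B'" by blast
      obtain B where B: "B \<in> \<pi>2" "j = pv B" using j by blast
      have eq: "pt B = pv B'" using B B' \<sigma> by simp
      have "Inl (pt B) \<in> B" "Inl (pv B') \<in> B'" using pvt B B' by (auto simp: L_def)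
      then have "B = B'" using disj[of B B'] B B' eq by (auto simp: \<pi>2_def)
      then show False using pvt[OF B(1)] eq by simp
    qed
    fix q :: "int ^ 'm" and p :: "int ^ 'n"
    assume ql: "coprime (q $ i) (p $ l)" and qp: "\<forall>j\<in>pv ` \<pi>2. coprime (q $ j) (q $ \<sigma> j)"
    have gcd1: "(GCD x\<in>B. stack q p $ x) = 1"
      if "a \<in> B" "b \<in> B" "coprime (stack q p $ a) (stack q p $ b)" for a b B
    proof -
      let ?g = "GCD x\<in>B. stack q p $ x"
      have "?g dvd stack q p $ a" "?g dvd stack q p $ b" using that by (auto intro: Gcd_dvd)
      then have "is_unit ?g" using that(3) by (meson coprime_common_divisor)
      moreover have "normalize ?g = ?g" by simp
      ultimately show ?thesis by (metis is_unit_normalize)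
    qed
    show "stack q p \<in> P \<pi>"
      unfolding P_def
    proof (intro CollectI ballI)
      fix B assume B: "B \<in> \<pi>"
      show "(GCD x\<in>B. stack q p $ x) = 1"
      proof (cases "B \<in> \<pi>2")
        case True
        then show ?thesis using pvt[OF True] qp \<sigma>[OF True]
          by (intro gcd1[of "Inl (pv B)" B "Inl (pt B)"]) (auto simp: L_def stack_def)
      next
        case False
        then have "Inl i \<in> B" "Inr l \<in> B" using il[OF B] B by (auto simp: \<pi>2_def)
        then show ?thesis using ql by (intro gcd1[of "Inl i" B "Inr l"]) (auto simp: stack_def)
      qed
    qed
  qed
qed

subsection \<open>The Khintchine--Groshev dichotomy\<close>

lemma emeasure_le_ennrealD: "emeasure M X \<le> ennreal c \<Longrightarrow> c \<ge> 0 \<Longrightarrow> measure M X \<le> c"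
  unfolding measure_def by (rule enn2real_leI)

text \<open>The set \<open>E j R\<close> of points in a ball that avoid every coprime approximation
  set from level \<open>j\<close> on is null by quasi-independence, and there are countably many
  pairs (j, R). Levels are restricted to \<open>divisor_sparse\<close>, where both the count of
  vectors and the local lower bound are available.\<close>

lemma AE_coprime_approx_infinitely_often:
  fixes i :: "'m::finite" and l :: "'n::finite" and h :: "nat \<Rightarrow> real"
  defines "T \<equiv> \<lambda>k. real k ^ (CARD('m) - 1) * h k ^ CARD('n)"
  assumes piv: "i \<notin> Piv" "\<And>j. j \<in> Piv \<Longrightarrow> \<sigma> j \<notin> Piv"
    and h: "\<And>k. 0 \<le> h k" "\<And>k. h k \<le> 1 / 4"
    and T: "\<And>x y. 1 \<le> x \<Longrightarrow> x \<le> y \<Longrightarrow> T y \<le> T x"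
    and div: "\<not> summable (\<lambda>k. T (Suc k))"
  shows "AE v in (lborel :: ((real ^ 'm ^ 'n) \<times> (real ^ 'n)) measure).
    \<forall>j. \<exists>k\<ge>j. \<exists>q\<in>coprime_vecs i Piv \<sigma> k. v \<in> coprime_approx_set i l q (h k)"
proof -
  define I where "I j = {q. \<exists>k\<ge>j. k \<in> divisor_sparse \<and> q \<in> coprime_vecs i Piv \<sigma> k}" for j
  define A' where "A' q = (coprime_approx_set i l q (h (int_supnorm q)) :: ((real ^ 'm ^ 'n) \<times> (real ^ 'n)) set)" for q
  define A where "A q = (approx_set q (h (int_supnorm q)) :: ((real ^ 'm ^ 'n) \<times> (real ^ 'n)) set)" for q :: "int ^ 'm"
  define w where "w q = h (int_supnorm q) ^ CARD('n)" for q :: "int ^ 'm"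
  define E where "E j R = ball 0 (real R) - (\<Union>q\<in>I j. A' q)" for j R
  have [measurable]: "A q \<in> sets borel" "A' q \<in> sets borel" for q unfolding A_def A'_def by measurable
  have [measurable]: "E j R \<in> sets borel" for j R unfolding E_def by measurable
  have Iq: "int_supnorm q \<in> divisor_sparse" "int_supnorm q \<ge> j" "q \<in> coprime_vecs i Piv \<sigma> (int_supnorm q)"
    if q: "q \<in> I j" for q j
  proof -
    obtain k where k: "k \<ge> j" "k \<in> divisor_sparse" "q \<in> coprime_vecs i Piv \<sigma> k" using q by (auto simp: I_def)
    moreover have "int_supnorm q = k" by (rule int_supnorm_coprime_vecs[OF k(3)])
    ultimately show "int_supnorm q \<in> divisor_sparse" "int_supnorm q \<ge> j"
      "q \<in> coprime_vecs i Piv \<sigma> (int_supnorm q)" by simp_all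
  qed
  have w0: "w q \<ge> 0" for q using h by (simp add: w_def)
  have T0: "T k \<ge> 0" for k using h by (simp add: T_def)
  have null: "emeasure lborel (E j R) = 0" for j R
  proof -
    obtain C where C: "C > 0"
      and single: "\<And>(q :: int ^ 'm) r. r \<ge> 0 \<Longrightarrow>
        emeasure lborel (cball 0 (real R) \<inter> approx_set q r :: ((real ^ 'm ^ 'n) \<times> (real ^ 'n)) set)
          \<le> ennreal (C * r ^ CARD('n))"
      and pair: "\<And>(q :: int ^ 'm) q' r r'. q \<noteq> q' \<Longrightarrow> r \<ge> 0 \<Longrightarrow> r' \<ge> 0 \<Longrightarrow>
        emeasure lborel (cball 0 (real R) \<inter> approx_set q r \<inter> approx_set q' r' :: ((real ^ 'm ^ 'n) \<times> (real ^ 'n)) set)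
          \<le> ennreal (C * (r ^ CARD('n) * r' ^ CARD('n)))"
      by (rule approx_set_upper_bounds[where R = "real R" and 'm = 'm and 'n = 'n], rule that, assumption+)
    \<comment> \<open>The lower bound (r/5)^n / 2 splits into the weight r^n and this constant
      \<open>c\<close>.\<close>
    show ?thesis
    proof (rule quasi_independent_avoid_null[where A = A and A' = A' and w = w and I = "I j" and R = "real R"
          and C = C and c = "(1 / 5) ^ CARD('n) / 2"])
      show "A' q \<subseteq> A q" for q unfolding A_def A'_def by (rule coprime_approx_set_subset)
      show "measure lborel (cball 0 (real R) \<inter> A q) \<le> C * w q" for q
        unfolding A_def w_def using h C by (intro emeasure_le_ennrealD single) auto
      show "measure lborel (cball 0 (real R) \<inter> A q \<inter> A q') \<le> C * (w q * w q')" if "q \<noteq> q'" for q q'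
        unfolding A_def w_def using h C that by (intro emeasure_le_ennrealD pair) auto
    next
      fix U :: "((real ^ 'm ^ 'n) \<times> (real ^ 'n)) set"
      assume U: "open U" "bounded U"
      obtain M where M: "\<And>(q :: int ^ 'm) a r. q $ i = int a \<Longrightarrow> a \<in> divisor_sparse \<Longrightarrow> a \<ge> M \<Longrightarrow> 0 \<le> r \<Longrightarrow> r \<le> 1 / 4 \<Longrightarrow>
          ennreal ((r / 5) ^ CARD('n)) * emeasure lborel U \<le> 2 * emeasure lborel (U \<inter> coprime_approx_set i l q r)"
        using coprime_approx_set_lower_bound[OF U, of i l] by blast
      have fin: "emeasure lborel X = ennreal (measure lborel X)" if "X \<subseteq> U" for X
        using emeasure_bounded_finite[OF bounded_subset[OF U(2) that]]
        by (intro emeasure_eq_ennreal_measure) auto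
      have "(1 / 5) ^ CARD('n) / 2 * w q * measure lborel U \<le> measure lborel (U \<inter> A' q)"
        if "q \<in> I j" "\<not> int_supnorm q < M" for q
      proof -
        note q = Iq[OF that(1)]
        have "ennreal ((h (int_supnorm q) / 5) ^ CARD('n)) * ennreal (measure lborel U) \<le> 2 * ennreal (measure lborel (U \<inter> A' q))"
          using M[of q "int_supnorm q" "h (int_supnorm q)"] q that h fin[of U] fin[of "U \<inter> A' q"]
          by (simp add: A'_def coprime_vecs_def)
        then have "ennreal ((h (int_supnorm q) / 5) ^ CARD('n) * measure lborel U) \<le> ennreal (2 * measure lborel (U \<inter> A' q))"
          using h by (simp add: ennreal_mult')
        then have "(h (int_supnorm q) / 5) ^ CARD('n) * measure lborel U \<le> 2 * measure lborel (U \<inter> A' q)"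
          by (subst (asm) ennreal_le_iff) auto
        then show ?thesis by (simp add: w_def power_divide)
      qed
      moreover have "finite {q :: int ^ 'm. int_supnorm q < M}"
      proof -
        have "{q :: int ^ 'm. int_supnorm q < M} = (\<Union>k<M. {q. int_supnorm q = k})" by auto
        then show ?thesis using finite_int_shell by auto
      qed
      ultimately show "\<exists>J. finite J \<and> (\<forall>q\<in>I j - J. (1 / 5) ^ CARD('n) / 2 * w q * measure lborel U \<le> measure lborel (U \<inter> A' q))"
        by (intro exI[of _ "{q. int_supnorm q < M}"]) auto
    next
      fix J :: "(int ^ 'm) set" and b :: real
      assume J: "finite J"
      \<comment> \<open>Beyond \<open>k1\<close> the level is at least \<open>j\<close>, exceeds the
        counting threshold 400, and avoids the norms of all vectors in \<open>J\<close>.\<close>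
      define k1 where "k1 = Suc (Max (insert j (insert 400 (int_supnorm ` J))))"
      have k1: "k < k1" if "k \<in> insert j (insert 400 (int_supnorm ` J))" for k
        unfolding k1_def less_Suc_eq_le by (rule Max_ge[OF _ that]) (use J in simp)
      define c where "c = (1 / 10 :: real) ^ (CARD('m) - 1)"
      have c: "c > 0" by (simp add: c_def)
      \<comment> \<open>The factor 16/3 undoes the density 3/16, division by \<open>c\<close> the
        loss of 1/10 per free coordinate, and the initial sum pays for the discarded levels below
        \<open>k1\<close>.\<close>
      obtain N where N: "(\<Sum>k<N. T (Suc k)) > 16 / 3 * (b / c + (\<Sum>k<k1. T k))"
        using div summableI_nonneg_bounded[of "\<lambda>k. T (Suc k)"] T0 by (meson not_le)
      have "b / c + (\<Sum>k<k1. T k) \<le> 3 / 16 * (\<Sum>k=1..N. T k)"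
      proof -
        have "(\<Sum>k=1..N. T k) = (\<Sum>k<N. T (Suc k))" using sum.atLeast1_atMost_eq[of T N] by simp
        then have "16 / 3 * (b / c + (\<Sum>k<k1. T k)) \<le> (\<Sum>k=1..N. T k)" using N by simp
        from mult_left_mono[OF this, of "3 / 16"] show ?thesis by simp
      qed
      also have "\<dots> \<le> (\<Sum>k\<in>{1..N} \<inter> divisor_sparse. T k)" by (rule sum_divisor_sparse_ge) (use T T0 in auto)
      also have "\<dots> \<le> (\<Sum>k\<in>{..<k1} \<union> ({k1..N} \<inter> divisor_sparse). T k)" by (intro sum_mono2) (use T0 in auto)
      also have "\<dots> = (\<Sum>k<k1. T k) + (\<Sum>k\<in>{k1..N} \<inter> divisor_sparse. T k)" by (intro sum.union_disjoint) auto
      finally have "b / c \<le> (\<Sum>k\<in>{k1..N} \<inter> divisor_sparse. T k)" by simp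
      then have "b \<le> c * (\<Sum>k\<in>{k1..N} \<inter> divisor_sparse. T k)" using c by (simp add: pos_divide_le_eq mult.commute)
      also have "\<dots> = (\<Sum>k\<in>{k1..N} \<inter> divisor_sparse. (real k / 10) ^ (CARD('m) - 1) * h k ^ CARD('n))"
        by (simp add: sum_distrib_left c_def T_def power_divide)
      also have "\<dots> \<le> (\<Sum>k\<in>{k1..N} \<inter> divisor_sparse. real (card (coprime_vecs i Piv \<sigma> k)) * h k ^ CARD('n))"
        using k1[of 400] h piv by (intro sum_mono mult_right_mono card_coprime_vecs_ge) auto
      also have "\<dots> = (\<Sum>k\<in>{k1..N} \<inter> divisor_sparse. sum w (coprime_vecs i Piv \<sigma> k))"
      proof (intro sum.cong refl)
        fix k
        have "sum w (coprime_vecs i Piv \<sigma> k) = (\<Sum>q\<in>coprime_vecs i Piv \<sigma> k. h k ^ CARD('n))"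
          by (intro sum.cong refl) (simp add: w_def int_supnorm_coprime_vecs)
        then show "real (card (coprime_vecs i Piv \<sigma> k)) * h k ^ CARD('n) = sum w (coprime_vecs i Piv \<sigma> k)" by simp
      qed
      also have "\<dots> = sum w (\<Union>k\<in>{k1..N} \<inter> divisor_sparse. coprime_vecs i Piv \<sigma> k)"
        by (rule sum.UNION_disjoint[symmetric]) (auto dest: int_supnorm_coprime_vecs simp: finite_coprime_vecs)
      finally have b: "b \<le> sum w (\<Union>k\<in>{k1..N} \<inter> divisor_sparse. coprime_vecs i Piv \<sigma> k)" .
      have "(\<Union>k\<in>{k1..N} \<inter> divisor_sparse. coprime_vecs i Piv \<sigma> k) \<subseteq> I j - J"
      proof
        fix q assume "q \<in> (\<Union>k\<in>{k1..N} \<inter> divisor_sparse. coprime_vecs i Piv \<sigma> k)"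
        then obtain k where k: "k \<ge> k1" "k \<in> divisor_sparse" "q \<in> coprime_vecs i Piv \<sigma> k" by auto
        then have "k \<ge> j" "int_supnorm q = k" using k1[of j] int_supnorm_coprime_vecs[of q] by auto
        moreover have "q \<notin> J" using k1[of k] k \<open>int_supnorm q = k\<close> by auto
        ultimately show "q \<in> I j - J" using k by (auto simp: I_def)
      qed
      then show "\<exists>F. finite F \<and> F \<subseteq> I j - J \<and> b \<le> sum w F"
        using b finite_coprime_vecs by (intro exI[of _ "\<Union>k\<in>{k1..N} \<inter> divisor_sparse. coprime_vecs i Piv \<sigma> k"]) auto
    qed (use w0 C in \<open>auto simp: E_def\<close>)
  qed
  have "AE v in lborel. v \<notin> E j R" for j R
    using null by (intro AE_not_in) (auto simp: null_sets_def)
  then have "AE v in lborel. \<forall>j R. v \<notin> E j R" by (simp add: AE_all_countable)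
  then show ?thesis
  proof (rule AE_mp, intro AE_I2 impI allI)
    fix v :: "(real ^ 'm ^ 'n) \<times> (real ^ 'n)" and j
    assume v: "\<forall>j R. v \<notin> E j R"
    obtain R :: nat where "norm v < real R" using reals_Archimedean2 by blast
    then obtain q where q: "q \<in> I j" "v \<in> A' q" using v by (auto simp: E_def)
    then show "\<exists>k\<ge>j. \<exists>q\<in>coprime_vecs i Piv \<sigma> k. v \<in> coprime_approx_set i l q (h k)"
      using Iq[OF q(1)] unfolding A'_def by blast
  qed
qed

section \<open>The convergence half\<close>

lemma finite_translated_int_vecs: "finite {p :: int ^ 'n. infnorm (x + real_vec p) \<le> r}"
proof (rule finite_subset)
  show "finite {p :: int ^ 'n. \<forall>k. p $ k \<in> {\<lfloor>- r - x $ k\<rfloor>..\<lceil>r - x $ k\<rceil>}}"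
    by (rule finite_vec_box) auto
  show "{p :: int ^ 'n. infnorm (x + real_vec p) \<le> r} \<subseteq> {p. \<forall>k. p $ k \<in> {\<lfloor>- r - x $ k\<rfloor>..\<lceil>r - x $ k\<rceil>}}"
  proof clarify
    fix p :: "int ^ 'n" and k
    assume "infnorm (x + real_vec p) \<le> r"
    then have "\<bar>x $ k + of_int (p $ k)\<bar> \<le> r" by (auto simp: infnorm_vec_le_iff real_vec_def)
    then show "p $ k \<in> {\<lfloor>- r - x $ k\<rfloor>..\<lceil>r - x $ k\<rceil>}" by (auto simp: abs_le_iff) linarith+
  qed
qed

lemma AE_finite_approx:
  fixes \<psi> :: "nat \<Rightarrow> real"
  assumes \<psi>: "\<forall>x\<ge>1. \<psi> x > 0"
    and sum: "summable (\<lambda>j. real (Suc j) ^ (CARD('m) - 1) * \<psi> (Suc j) ^ CARD('n))"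
  shows "AE v in (lborel :: ((real ^ 'm::finite ^ 'n::finite) \<times> (real ^ 'n)) measure).
    finite {stack q p | (q :: int ^ 'm) (p :: int ^ 'n). q \<noteq> 0 \<and> infnorm (residual q v + real_vec p) \<le> \<psi> (int_supnorm q)}"
proof -
  \<comment> \<open>Index \<open>k\<close> stands for the shell of norm k + 1, which leaves out q =
    0 and matches the shifted series.\<close>
  define A where "A R k = (\<Union>q\<in>{q :: int ^ 'm. int_supnorm q = Suc k}. cball 0 (real R) \<inter> approx_set q (\<psi> (Suc k)) :: ((real ^ 'm ^ 'n) \<times> (real ^ 'n)) set)" for R k
  have [measurable]: "A R k \<in> sets borel" for R k unfolding A_def by measurable
  have "AE v in lborel. eventually (\<lambda>k. v \<in> space lborel - A R k) sequentially" for R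
  proof (rule borel_cantelli_AE1)
    have "A R k \<subseteq> cball 0 (real R)" for k by (auto simp: A_def)
    then show "emeasure lborel (A R k) < \<infinity>" for k
      using emeasure_bounded_finite[OF bounded_subset[OF bounded_cball]] by blast
    obtain C where C: "C > 0"
      and single: "\<And>(q :: int ^ 'm) r. r \<ge> 0 \<Longrightarrow>
        emeasure lborel (cball 0 (real R) \<inter> approx_set q r :: ((real ^ 'm ^ 'n) \<times> (real ^ 'n)) set)
          \<le> ennreal (C * r ^ CARD('n))"
      by (rule approx_set_upper_bounds[where R = "real R" and 'm = 'm and 'n = 'n], rule that, assumption+)
    define D where "D = real (CARD('m)) * 2 * 3 ^ (CARD('m) - 1) * C"
    have "measure lborel (A R k) \<le> D * (real (Suc k) ^ (CARD('m) - 1) * \<psi> (Suc k) ^ CARD('n))" for k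
    proof -
      have \<psi>0: "\<psi> (Suc k) \<ge> 0" using \<psi> by (simp add: less_imp_le)
      have "measure lborel (A R k) \<le> (\<Sum>q\<in>{q :: int ^ 'm. int_supnorm q = Suc k}.
          measure lborel (cball 0 (real R) \<inter> approx_set q (\<psi> (Suc k)) :: ((real ^ 'm ^ 'n) \<times> (real ^ 'n)) set))"
        unfolding A_def
        by (intro measure_UNION_le finite_int_shell) auto
      also have "\<dots> \<le> (\<Sum>q\<in>{q :: int ^ 'm. int_supnorm q = Suc k}. C * \<psi> (Suc k) ^ CARD('n))"
        using C \<psi>0 by (intro sum_mono emeasure_le_ennrealD single) auto
      also have "\<dots> = real (card {q :: int ^ 'm. int_supnorm q = Suc k}) * (C * \<psi> (Suc k) ^ CARD('n))" by simp
      also have "\<dots> \<le> (real (CARD('m)) * 2 * 3 ^ (CARD('m) - 1) * real (Suc k) ^ (CARD('m) - 1)) * (C * \<psi> (Suc k) ^ CARD('n))"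
        using C \<psi>0 by (intro mult_right_mono card_int_shell_le) auto
      also have "\<dots> = D * (real (Suc k) ^ (CARD('m) - 1) * \<psi> (Suc k) ^ CARD('n))" by (simp only: D_def mult_ac)
      finally show ?thesis .
    qed
    then show "summable (\<lambda>k. measure lborel (A R k))"
      by (intro summable_comparison_test'[OF summable_mult[OF sum, of D], of 0]) auto
  qed measurable
  then have "AE v in lborel. \<forall>R. eventually (\<lambda>k. v \<notin> A R k) sequentially" by (simp add: AE_all_countable)
  then show ?thesis
  proof (rule AE_mp, intro AE_I2 impI)
    fix v :: "(real ^ 'm ^ 'n) \<times> (real ^ 'n)"
    assume v: "\<forall>R. eventually (\<lambda>k. v \<notin> A R k) sequentially"
    obtain R :: nat where R: "norm v < real R" using reals_Archimedean2 by blast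
    obtain k0 where k0: "\<And>k. k \<ge> k0 \<Longrightarrow> v \<notin> A R k" using v unfolding eventually_sequentially by blast
    let ?F = "\<lambda>q. {p :: int ^ 'n. infnorm (residual q v + real_vec p) \<le> \<psi> (int_supnorm q)}"
    \<comment> \<open>Borel--Cantelli leaves finitely many q; each of them admits only finitely many
      p, since p is confined to a bounded box.\<close>
    have "{stack q p | (q :: int ^ 'm) (p :: int ^ 'n). q \<noteq> 0 \<and> infnorm (residual q v + real_vec p) \<le> \<psi> (int_supnorm q)}
      \<subseteq> (\<lambda>(q, p). stack q p) ` Sigma (\<Union>k\<le>k0. {q. int_supnorm q = k}) ?F"
    proof clarify
      fix q :: "int ^ 'm" and p :: "int ^ 'n"
      assume q: "q \<noteq> 0" and p: "infnorm (residual q v + real_vec p) \<le> \<psi> (int_supnorm q)"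
      obtain k where k: "int_supnorm q = Suc k" using q int_supnorm_eq_0_iff by (metis not0_implies_Suc)
      have "v \<in> A R k" using R p k by (auto simp: A_def approx_set_def)
      then have "k < k0" using k0 not_le by blast
      then show "stack q p \<in> (\<lambda>(q, p). stack q p) ` Sigma (\<Union>k\<le>k0. {q. int_supnorm q = k}) ?F"
        using k p by force
    qed
    moreover have "finite (Sigma (\<Union>k\<le>k0. {q :: int ^ 'm. int_supnorm q = k}) ?F)"
      by (intro finite_SigmaI finite_UN_I finite_int_shell finite_translated_int_vecs) auto
    ultimately show "finite {stack q p | (q :: int ^ 'm) (p :: int ^ 'n). q \<noteq> 0 \<and> infnorm (residual q v + real_vec p) \<le> \<psi> (int_supnorm q)}"
      by (meson finite_imageI finite_subset)
  qed
qed

section \<open>Truncation to radii at most 1/4, and the conclusion\<close>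

lemma truncate_approx_function:
  fixes \<psi> :: "nat \<Rightarrow> real" and d n :: nat
  assumes n: "n \<ge> 1" and pos: "\<forall>x\<ge>1. \<psi> x > 0"
    and anti: "antimono_on {1..} (\<lambda>x. real x ^ d * \<psi> x ^ n)"
    and div: "\<not> summable (\<lambda>j. real (Suc j) ^ d * \<psi> (Suc j) ^ n)"
  obtains h where "\<And>k. 0 \<le> h k" "\<And>k. h k \<le> 1 / 4" "\<And>k. k \<ge> 1 \<Longrightarrow> h k \<le> \<psi> k"
    "\<And>x y. 1 \<le> x \<Longrightarrow> x \<le> y \<Longrightarrow> real y ^ d * h y ^ n \<le> real x ^ d * h x ^ n"
    "\<not> summable (\<lambda>j. real (Suc j) ^ d * h (Suc j) ^ n)"
proof -
  \<comment> \<open>Truncating the whole summand, rather than \<open>\<psi>\<close>, preserves monotonicity.\<close>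
  define t where "t x = real x ^ d * \<psi> x ^ n" for x
  define T where "T x = min (t x) ((1 / 4) ^ n)" for x
  \<comment> \<open>Here h is the function whose summand is \<open>T\<close>. Its value at 0 is set
    to 0, because the bounds 0 \<le> h \<le> 1/4 are to hold at every argument.\<close>
  define h where "h x = (if x = 0 then 0 else root n (T x / real x ^ d))" for x
  have t0: "t x > 0" if "x \<ge> 1" for x using that pos by (simp add: t_def)
  have T0: "T x > 0" if "x \<ge> 1" for x using that t0 by (simp add: T_def)
  have hn: "h x ^ n = T x / real x ^ d" if "x \<ge> 1" for x
    using that n T0[OF that] by (simp add: h_def)
  then have hT: "real x ^ d * h x ^ n = T x" if "x \<ge> 1" for x using that by simp
  have h0: "0 \<le> h x" for x
    using n T0[of x] by (cases "x = 0") (auto simp: h_def less_imp_le)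
  show thesis
  proof (rule that)
    show "0 \<le> h k" for k by (rule h0)
    show "h k \<le> 1 / 4" for k
    proof (cases "k = 0")
      case False
      then have "T k / real k ^ d \<le> T k / 1" using T0[of k] by (intro divide_left_mono) auto
      also have "\<dots> \<le> (1 / 4) ^ n" by (simp add: T_def)
      finally have "h k ^ n \<le> (1 / 4) ^ n" using hn[of k] False by simp
      then show ?thesis using h0[of k] n by (subst (asm) power_mono_iff) auto
    qed (simp add: h_def)
    show "h k \<le> \<psi> k" if "k \<ge> 1" for k
    proof -
      have "T k / real k ^ d \<le> t k / real k ^ d" by (intro divide_right_mono) (auto simp: T_def)
      then have "h k ^ n \<le> \<psi> k ^ n" using hn[of k] that by (simp add: t_def)
      then show ?thesis using n pos that by (metis less_imp_le power_mono_iff h0 less_eq_Suc_le One_nat_def)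
    qed
    show "real y ^ d * h y ^ n \<le> real x ^ d * h x ^ n" if "1 \<le> x" "x \<le> y" for x y
    proof -
      have "t y \<le> t x" using anti that unfolding t_def monotone_on_def by auto
      then show ?thesis using hT[of x] hT[of y] that by (simp add: T_def min_le_iff_disj)
    qed
    show "\<not> summable (\<lambda>j. real (Suc j) ^ d * h (Suc j) ^ n)"
    proof
      assume "summable (\<lambda>j. real (Suc j) ^ d * h (Suc j) ^ n)"
      moreover have "(\<lambda>j. real (Suc j) ^ d * h (Suc j) ^ n) = (\<lambda>j. T (Suc j))"
        by (rule ext, rule hT) simp
      ultimately have sT: "summable (\<lambda>j. T (Suc j))" by (simp only:)
      \<comment> \<open>Convergence would force the terms \<open>T\<close> to 0, hence eventually
        below the cap, where \<open>T\<close> and \<open>t\<close> agree; then the original series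
        would converge as well.\<close>
      then have "(\<lambda>j. T (Suc j)) \<longlonglongrightarrow> 0" by (rule summable_LIMSEQ_zero)
      then have "eventually (\<lambda>j. T (Suc j) < (1 / 4) ^ n) sequentially" by (rule order_tendstoD) simp
      then have "eventually (\<lambda>j. T (Suc j) = t (Suc j)) sequentially"
        by (rule eventually_mono) (auto simp: T_def min_def split: if_splits)
      then have "summable (\<lambda>j. t (Suc j))" using sT summable_cong by fast
      then show False using div by (simp add: t_def)
    qed
  qed
qed

theorem theorem1p1:
  fixes \<pi> :: "('m::finite + 'n::finite) set set"
    and \<psi> :: "nat \<Rightarrow> real"
  assumes "partition_on UNIV \<pi>"
    and "\<forall>B\<in>\<pi>. card B \<ge> CARD('n) + 1"
    and "\<forall>x\<ge>1. \<psi> x > 0"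
    and "antimono_on {1..} (\<lambda>x. real x ^ (CARD('m) - 1) * \<psi> x ^ CARD('n))"
  shows "(\<not> summable (\<lambda>j. real (Suc j) ^ (CARD('m) - 1) * \<psi> (Suc j) ^ CARD('n)) \<longrightarrow>
           (AE (\<Theta>, y) in (lebesgue :: ((real ^ 'm ^ 'n) \<times> (real ^ 'n)) measure).
             infinite {stack q p | (q :: int ^ 'm) (p :: int ^ 'n).
               stack q p \<in> P \<pi> \<and> q \<noteq> 0 \<and>
               infnorm (\<Theta> *v real_vec q + real_vec p - y) \<le> \<psi> (int_supnorm q)})) \<and>
         (summable (\<lambda>j. real (Suc j) ^ (CARD('m) - 1) * \<psi> (Suc j) ^ CARD('n)) \<longrightarrow>
           (AE (\<Theta>, y) in (lebesgue :: ((real ^ 'm ^ 'n) \<times> (real ^ 'n)) measure).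
             finite {stack q p | (q :: int ^ 'm) (p :: int ^ 'n).
               q \<noteq> 0 \<and>
               infnorm (\<Theta> *v real_vec q + real_vec p - y) \<le> \<psi> (int_supnorm q)}))"
proof (intro conjI impI)
  have res: "fst v *v real_vec q + real_vec p - snd v = residual q v + real_vec p"
    for v :: "(real ^ 'm ^ 'n) \<times> (real ^ 'n)" and q p
    by (simp add: residual_def algebra_simps)
  {
    assume div: "\<not> summable (\<lambda>j. real (Suc j) ^ (CARD('m) - 1) * \<psi> (Suc j) ^ CARD('n))"
    obtain h where h: "\<And>k. 0 \<le> h k" "\<And>k. h k \<le> 1 / 4" "\<And>k. k \<ge> 1 \<Longrightarrow> h k \<le> \<psi> k"
      "\<And>x y. 1 \<le> x \<Longrightarrow> x \<le> y \<Longrightarrow> real y ^ (CARD('m) - 1) * h y ^ CARD('n) \<le> real x ^ (CARD('m) - 1) * h x ^ CARD('n)"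
      "\<not> summable (\<lambda>j. real (Suc j) ^ (CARD('m) - 1) * h (Suc j) ^ CARD('n))"
      by (rule truncate_approx_function[OF _ assms(3,4) div]) (auto simp: Suc_le_eq)
    obtain i :: 'm and l :: 'n and Piv \<sigma> where piv: "i \<notin> Piv" "\<And>j. j \<in> Piv \<Longrightarrow> \<sigma> j \<notin> Piv"
      and prim: "\<And>q p. coprime (q $ i) (p $ l) \<Longrightarrow> (\<forall>j\<in>Piv. coprime (q $ j) (q $ \<sigma> j)) \<Longrightarrow> stack q p \<in> P \<pi>"
      by (rule partition_pivots[OF assms(1,2)], rule that, assumption+)
    have "AE v in (lborel :: ((real ^ 'm ^ 'n) \<times> (real ^ 'n)) measure).
        \<forall>j. \<exists>k\<ge>j. \<exists>q\<in>coprime_vecs i Piv \<sigma> k. v \<in> coprime_approx_set i l q (h k)"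
      by (rule AE_coprime_approx_infinitely_often) (use piv h in blast)+
    then have "AE v in (lborel :: ((real ^ 'm ^ 'n) \<times> (real ^ 'n)) measure).
        infinite {stack q p | (q :: int ^ 'm) (p :: int ^ 'n).
               stack q p \<in> P \<pi> \<and> q \<noteq> 0 \<and> infnorm (residual q v + real_vec p) \<le> \<psi> (int_supnorm q)}"
    proof (rule AE_mp, intro AE_I2 impI notI)
      fix v :: "(real ^ 'm ^ 'n) \<times> (real ^ 'n)"
      let ?X = "{stack q p | (q :: int ^ 'm) (p :: int ^ 'n).
               stack q p \<in> P \<pi> \<and> q \<noteq> 0 \<and> infnorm (residual q v + real_vec p) \<le> \<psi> (int_supnorm q)}"
      assume io: "\<forall>j. \<exists>k\<ge>j. \<exists>q\<in>coprime_vecs i Piv \<sigma> k. v \<in> coprime_approx_set i l q (h k)"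
        and "finite ?X"
      \<comment> \<open>Recovering q from the stacked vector shows that a finite solution set has
        bounded norms |q|.\<close>
      define qpart where "qpart z = (\<chi> a. z $ Inl a)" for z :: "int ^ ('m + 'n)"
      have qpart: "qpart (stack q p) = q" for q p by (simp add: qpart_def stack_def vec_eq_iff)
      have fin: "finite ((\<lambda>z. int_supnorm (qpart z)) ` ?X)" using \<open>finite ?X\<close> by simp
      then obtain b where b: "\<And>k. k \<in> (\<lambda>z. int_supnorm (qpart z)) ` ?X \<Longrightarrow> k \<le> b"
        unfolding finite_nat_set_iff_bounded_le by blast
      \<comment> \<open>A level above \<open>b\<close> contradicts this bound; it is also at least
        1, so q is nonzero and h k \<le> \<psi> k applies.\<close>
      obtain k q where k: "k \<ge> Suc b" "q \<in> coprime_vecs i Piv \<sigma> k" "v \<in> coprime_approx_set i l q (h k)"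
        using io by blast
      then obtain p where p: "coprime (q $ i) (p $ l)" "infnorm (residual q v + real_vec p) \<le> h k"
        by (auto simp: coprime_approx_set_def)
      have qk: "int_supnorm q = k" using k int_supnorm_coprime_vecs by blast
      have "q \<noteq> 0" using qk k(1) int_supnorm_eq_0_iff[of q] by auto
      moreover have "stack q p \<in> P \<pi>" using p k by (intro prim) (auto simp: coprime_vecs_def)
      moreover have "infnorm (residual q v + real_vec p) \<le> \<psi> (int_supnorm q)"
        using p(2) h(3)[of k] k(1) qk by simp
      ultimately have "stack q p \<in> ?X" by blast
      then have "int_supnorm (qpart (stack q p)) \<le> b" by (intro b imageI)
      then show False using k(1) qk by (simp add: qpart)
    qed
    then show "AE (\<Theta>, y) in (lebesgue :: ((real ^ 'm ^ 'n) \<times> (real ^ 'n)) measure).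
             infinite {stack q p | (q :: int ^ 'm) (p :: int ^ 'n).
               stack q p \<in> P \<pi> \<and> q \<noteq> 0 \<and>
               infnorm (\<Theta> *v real_vec q + real_vec p - y) \<le> \<psi> (int_supnorm q)}"
      unfolding case_prod_beta res by (rule AE_completion)
  next
    assume "summable (\<lambda>j. real (Suc j) ^ (CARD('m) - 1) * \<psi> (Suc j) ^ CARD('n))"
    from AE_finite_approx[OF assms(3) this]
    show "AE (\<Theta>, y) in (lebesgue :: ((real ^ 'm ^ 'n) \<times> (real ^ 'n)) measure).
             finite {stack q p | (q :: int ^ 'm) (p :: int ^ 'n).
               q \<noteq> 0 \<and>
               infnorm (\<Theta> *v real_vec q + real_vec p - y) \<le> \<psi> (int_supnorm q)}"
      unfolding case_prod_beta res by (rule AE_completion)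
  }
qed

end
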